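(* The four dimensional vector space $V_\delta:=S(s\ell(2)^* )_{[1]}\otimes\mathbb C_\delta=\mathbb C\langle1_V,R^X,R^Y,R^Z\rangle\otimes\mathbb C_\delta$, with basis $\mathbf 1=1_V\otimes1_{\mathbb C_\delta}$, $\mathbf R^X=R^X\otimes1_{\mathbb C_\delta}$, $\mathbf R^Y=R^Y\otimes1_{\mathbb C_\delta}$, $\mathbf R^Z=R^Z\otimes1_{\mathbb C_\delta}$, is a (right-left) SAYD module over the Schwarzian Hopf algebra $\mathcal H_{1\rm S}^{\rm cop}$ via the right action $$\begin{array}{c|ccc}\triangleleft&X&Y&\delta_1\\\hline\mathbf 1&0&\mathbf 1&\mathbf R^Z\\\mathbf R^X&-\mathbf R^Y&2\mathbf R^X&0\\\mathbf R^Y&-\mathbf R^Z&\mathbf R^Y&0\\\mathbf R^Z&0&0&0\end{array}$$ and the left coaction $\nabla:V_\delta\to\mathcal H_{1\rm S}^{\rm cop}\otimes V_\delta$, $$\mathbf 1\mapsto1\otimes\mathbf 1+X\otimes\mathbf R^X+Y\otimes\mathbf R^Y,\quad\mathbf R^X\mapsto1\otimes\mathbf R^X,\quad\mathbf R^Y\mapsto1\otimes\mathbf R^Y+\delta_1\otimes\mathbf R^X,$$ $$\mathbf R^Z\mapsto1\otimes\mathbf R^Z+\delta_1\otimes\mathbf R^Y+\tfrac12\delta_1^2\otimes\mathbf R^X.$$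
   Context: Everything is over $\mathbb C$. **The Hopf algebra.** $\mathcal H_{1\rm S}^{\rm cop}\cong\mathbb C[\delta_1]\blacktriangleright\!\!\vartriangleleft U(g\ell(1)^{\rm aff})$ is the Hopf algebra generated as an algebra by $X,Y,\delta_1$ with relations $[Y,X]=X$, $[Y,\delta_1]=\delta_1$, $[X,\delta_1]=\tfrac12\delta_1^2$, with $\Delta(X)=X\otimes1+1\otimes X+Y\otimes\delta_1$, $\Delta(Y)=Y\otimes1+1\otimes Y$, $\Delta(\delta_1)=\delta_1\otimes1+1\otimes\delta_1$, $\varepsilon(X)=\varepsilon(Y)=\varepsilon(\delta_1)=0$, $S(X)=-X+Y\delta_1$, $S(Y)=-Y$, $S(\delta_1)=-\delta_1$. **The module.** $S(s\ell(2)^* )_{[1]}$ is the symmetric algebra of $s\ell(2)^*$ truncated above degree 1, where $s\ell(2)=\langle X,Y,Z\rangle$ with $[Y,X]=X$, $[Z,X]=Y$, $[Z,Y]=Z$, and $R^X,R^Y,R^Z$ is the dual basis. $\mathbb C_\delta$ is the one dimensional module of the character $\delta$ with $\delta(X)=0$, $\delta(Y)=1$, $\delta(\delta_1)=0$. **SAYD modules.** A right-left SAYD module over a Hopf algebra $H$ is a right $H$-module and left $H$-comodule $V$, $\nabla(v)=v_{\langle-1\rangle}\otimes v_{\langle0\rangle}$, such that $\nabla(v\cdot h)=S(h_{(3)})v_{\langle-1\rangle}h_{(1)}\otimes v_{\langle0\rangle}\cdot h_{(2)}$ and $v_{\langle0\rangle}\cdot v_{\langle-1\rangle}=v$ for all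 $v\in V$, $h\in H$. *)

theory Defs
  imports Complex_Main "HOL-Library.Poly_Mapping"
begin

section \<open>Complex vector spaces and algebras\<close>

class complex_vector = ab_group_add +
  fixes scaleC :: "complex \<Rightarrow> 'a \<Rightarrow> 'a"  (infixr "*\<^sub>C" 75)
  assumes scaleC_add_right: "c *\<^sub>C (x + y) = c *\<^sub>C x + c *\<^sub>C y"
    and scaleC_add_left: "(c + d) *\<^sub>C x = c *\<^sub>C x + d *\<^sub>C x"
    and scaleC_scaleC: "c *\<^sub>C d *\<^sub>C x = (c * d) *\<^sub>C x"
    and scaleC_one: "1 *\<^sub>C x = x"

global_interpretation complex_vector: vector_space "scaleC :: complex \<Rightarrow> 'a \<Rightarrow> 'a::complex_vector"
  by unfold_locales (simp_all add: scaleC_add_right scaleC_add_left scaleC_scaleC scaleC_one)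

global_interpretation complex_vector: vector_space_pair
  "scaleC :: complex \<Rightarrow> 'a \<Rightarrow> 'a::complex_vector" "scaleC :: complex \<Rightarrow> 'b \<Rightarrow> 'b::complex_vector"
  by standard

abbreviation clinear :: "('a::complex_vector \<Rightarrow> 'b::complex_vector) \<Rightarrow> bool"
  where "clinear \<equiv> Vector_Spaces.linear scaleC scaleC"

lemma clinear_iff:
  "clinear f \<longleftrightarrow> (\<forall>x y. f (x + y) = f x + f y) \<and> (\<forall>c x. f (c *\<^sub>C x) = c *\<^sub>C f x)"
  by (auto simp: Vector_Spaces.linear_iff complex_vector.vector_space_axioms)

definition cbilinear :: "('a::complex_vector \<Rightarrow> 'b::complex_vector \<Rightarrow> 'c::complex_vector) \<Rightarrow> bool"
  where "cbilinear f \<longleftrightarrow> (\<forall>a. clinear (f a)) \<and> (\<forall>b. clinear (\<lambda>a. f a b))"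

lemma cbilinearI:
  assumes "\<And>a b b'. f a (b + b') = f a b + f a b'" "\<And>a c b. f a (c *\<^sub>C b) = c *\<^sub>C f a b"
    "\<And>a a' b. f (a + a') b = f a b + f a' b" "\<And>a c b. f (c *\<^sub>C a) b = c *\<^sub>C f a b"
  shows "cbilinear f"
  using assms by (simp add: cbilinear_def clinear_iff)

text \<open>Unlike \<open>ring_1\<close>, the zero algebra is allowed.\<close>

class complex_algebra_1 = complex_vector + ring + monoid_mult +
  assumes mult_scaleC_left: "(c *\<^sub>C x) * y = c *\<^sub>C (x * y)"
    and mult_scaleC_right: "x * (c *\<^sub>C y) = c *\<^sub>C (x * y)"

instantiation complex :: complex_algebra_1
begin

definition scaleC_complex :: "complex \<Rightarrow> complex \<Rightarrow> complex"
  where [simp]: "scaleC_complex c x = c * x"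

instance by standard (simp_all add: algebra_simps)

end

definition alg_hom :: "('a::complex_algebra_1 \<Rightarrow> 'b::complex_algebra_1) \<Rightarrow> bool"
  where "alg_hom f \<longleftrightarrow> clinear f \<and> f 1 = 1 \<and> (\<forall>x y. f (x * y) = f x * f y)"


section \<open>Free vector spaces\<close>

text \<open>The free vector space on a type \<open>'k\<close> is \<^typ>\<open>'k \<Rightarrow>\<^sub>0 complex\<close>.\<close>

instantiation poly_mapping :: (type, complex_vector) complex_vector
begin

lift_definition scaleC_poly_mapping :: "complex \<Rightarrow> ('a \<Rightarrow>\<^sub>0 'b) \<Rightarrow> ('a \<Rightarrow>\<^sub>0 'b)"
  is "\<lambda>c f k. c *\<^sub>C f k"
  by (erule finite_subset[rotated]) auto

instance
  by standard (transfer; simp add: scaleC_add_right scaleC_add_left scaleC_scaleC scaleC_one)+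

end

lemma scaleC_single: "c *\<^sub>C Poly_Mapping.single k a = Poly_Mapping.single k (c *\<^sub>C a)"
  by transfer (auto simp: when_def)

lemma free_induct [case_names single add]:
  fixes p :: "'k \<Rightarrow>\<^sub>0 complex"
  assumes single: "\<And>k c. P (Poly_Mapping.single k c)" and add: "\<And>p q. P p \<Longrightarrow> P q \<Longrightarrow> P (p + q)"
  shows "P p"
proof (induction p rule: update_induct)
  case const
  then show ?case using single[of undefined 0] by simp
next
  case (update p a b)
  have "Poly_Mapping.update a b p = p + Poly_Mapping.single a b"
    using update(1)
    by (intro poly_mapping_eqI)
       (auto simp: lookup_update lookup_add lookup_single in_keys_iff when_def)
  then show ?case
    using add[OF update(3) single] by simp
qed

definition lin_ext :: "('k \<Rightarrow> 'v::complex_vector) \<Rightarrow> ('k \<Rightarrow>\<^sub>0 complex) \<Rightarrow> 'v"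
  where "lin_ext f p = (\<Sum>k\<in>Poly_Mapping.keys p. Poly_Mapping.lookup p k *\<^sub>C f k)"

lemma lin_ext_superset:
  "finite A \<Longrightarrow> Poly_Mapping.keys p \<subseteq> A \<Longrightarrow> lin_ext f p = (\<Sum>k\<in>A. Poly_Mapping.lookup p k *\<^sub>C f k)"
  unfolding lin_ext_def by (rule sum.mono_neutral_left) (auto simp: in_keys_iff)

lemma lin_ext_add: "lin_ext f (p + q) = lin_ext f p + lin_ext f q"
proof -
  let ?A = "Poly_Mapping.keys p \<union> Poly_Mapping.keys q"
  have "lin_ext f (p + q) = (\<Sum>k\<in>?A. Poly_Mapping.lookup (p + q) k *\<^sub>C f k)"
    by (rule lin_ext_superset) (use Poly_Mapping.keys_add[of p q] in auto)
  also have "\<dots> = (\<Sum>k\<in>?A. Poly_Mapping.lookup p k *\<^sub>C f k) + (\<Sum>k\<in>?A. Poly_Mapping.lookup q k *\<^sub>C f k)"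
    by (simp add: lookup_add scaleC_add_left sum.distrib)
  also have "\<dots> = lin_ext f p + lin_ext f q"
    by (subst (1 2) lin_ext_superset[where A = ?A]) auto
  finally show ?thesis .
qed

lemma lookup_scaleC [simp]: "Poly_Mapping.lookup (c *\<^sub>C p) k = c *\<^sub>C Poly_Mapping.lookup p k"
  by transfer simp

lemma lin_ext_scaleC: "lin_ext f (c *\<^sub>C p) = c *\<^sub>C lin_ext f p"
proof -
  have "lin_ext f (c *\<^sub>C p) = (\<Sum>k\<in>Poly_Mapping.keys p. Poly_Mapping.lookup (c *\<^sub>C p) k *\<^sub>C f k)"
    by (rule lin_ext_superset) (auto simp: in_keys_iff)
  then show ?thesis
    by (simp add: lin_ext_def complex_vector.scale_sum_right scaleC_scaleC)
qed

lemma clinear_lin_ext: "clinear (lin_ext f)"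
  by (simp add: clinear_iff lin_ext_add lin_ext_scaleC)

lemma lin_ext_diff: "lin_ext f (p - q) = lin_ext f p - lin_ext f q"
  by (rule complex_vector.linear_diff[OF clinear_lin_ext])

lemma lin_ext_single [simp]: "lin_ext f (Poly_Mapping.single k c) = c *\<^sub>C f k"
  by (simp add: lin_ext_def)

lemma lin_ext_fun_add: "lin_ext (\<lambda>k. f k + g k) p = lin_ext f p + lin_ext g p"
  by (simp add: lin_ext_def scaleC_add_right sum.distrib)

lemma lin_ext_fun_scaleC: "lin_ext (\<lambda>k. c *\<^sub>C f k) p = c *\<^sub>C lin_ext f p"
  by (simp add: lin_ext_def complex_vector.scale_sum_right scaleC_scaleC mult.commute)


section \<open>Tensor products over the complex numbers\<close>

inductive tensor_rel ::
  "(('a::complex_vector \<times> 'b::complex_vector) \<Rightarrow>\<^sub>0 complex) \<Rightarrow> (('a \<times> 'b) \<Rightarrow>\<^sub>0 complex) \<Rightarrow> bool"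
  where
    tensor_rel_refl: "tensor_rel p p"
  | tensor_rel_sym: "tensor_rel p q \<Longrightarrow> tensor_rel q p"
  | tensor_rel_trans: "tensor_rel p q \<Longrightarrow> tensor_rel q r \<Longrightarrow> tensor_rel p r"
  | tensor_rel_add: "tensor_rel p q \<Longrightarrow> tensor_rel p' q' \<Longrightarrow> tensor_rel (p + p') (q + q')"
  | tensor_rel_scale: "tensor_rel p q \<Longrightarrow> tensor_rel (c *\<^sub>C p) (c *\<^sub>C q)"
  | tensor_rel_add_left: "tensor_rel (Poly_Mapping.single (a + a', b) 1)
      (Poly_Mapping.single (a, b) 1 + Poly_Mapping.single (a', b) 1)"
  | tensor_rel_add_right: "tensor_rel (Poly_Mapping.single (a, b + b') 1)
      (Poly_Mapping.single (a, b) 1 + Poly_Mapping.single (a, b') 1)"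
  | tensor_rel_scale_left: "tensor_rel (Poly_Mapping.single (c *\<^sub>C a, b) 1) (c *\<^sub>C Poly_Mapping.single (a, b) 1)"
  | tensor_rel_scale_right: "tensor_rel (Poly_Mapping.single (a, c *\<^sub>C b) 1) (c *\<^sub>C Poly_Mapping.single (a, b) 1)"

quotient_type (overloaded) ('a, 'b) tensor = "('a::complex_vector \<times> 'b::complex_vector) \<Rightarrow>\<^sub>0 complex" / tensor_rel
  by (auto intro!: equivpI reflpI sympI transpI intro: tensor_rel_refl tensor_rel_sym tensor_rel_trans)

type_notation tensor ("(_ \<otimes>/ _)" [21, 20] 20)

lemma tensor_rel_uminus: "tensor_rel p q \<Longrightarrow> tensor_rel (- p) (- q)"
  using tensor_rel_scale[of p q "- 1"] by (simp add: scaleC_one)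

instantiation tensor :: (complex_vector, complex_vector) complex_vector
begin

lift_definition zero_tensor :: "'a \<otimes> 'b" is 0 .

lift_definition plus_tensor :: "('a \<otimes> 'b) \<Rightarrow> ('a \<otimes> 'b) \<Rightarrow> ('a \<otimes> 'b)" is "(+)"
  by (rule tensor_rel_add)

lift_definition uminus_tensor :: "('a \<otimes> 'b) \<Rightarrow> ('a \<otimes> 'b)" is uminus
  by (rule tensor_rel_uminus)

lift_definition minus_tensor :: "('a \<otimes> 'b) \<Rightarrow> ('a \<otimes> 'b) \<Rightarrow> ('a \<otimes> 'b)" is "(-)"
  using tensor_rel_add tensor_rel_uminus by fastforce

lift_definition scaleC_tensor :: "complex \<Rightarrow> ('a \<otimes> 'b) \<Rightarrow> ('a \<otimes> 'b)" is scaleC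
  by (rule tensor_rel_scale)

instance
  by standard (transfer; simp add: tensor_rel_refl algebra_simps scaleC_add_right scaleC_add_left
      scaleC_scaleC scaleC_one)+

end

lift_definition tensor_of :: "'a::complex_vector \<Rightarrow> 'b::complex_vector \<Rightarrow> 'a \<otimes> 'b"  (infixr "\<otimes>" 70)
  is "\<lambda>a b. Poly_Mapping.single (a, b) 1" .

lemma tensor_add_left: "(a + a') \<otimes> b = a \<otimes> b + a' \<otimes> b"
  by transfer (rule tensor_rel_add_left)

lemma tensor_add_right: "a \<otimes> (b + b') = a \<otimes> b + a \<otimes> b'"
  by transfer (rule tensor_rel_add_right)

lemma tensor_scaleC_left: "(c *\<^sub>C a) \<otimes> b = c *\<^sub>C (a \<otimes> b)"
  by transfer (rule tensor_rel_scale_left)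

lemma tensor_scaleC_right: "a \<otimes> (c *\<^sub>C b) = c *\<^sub>C (a \<otimes> b)"
  by transfer (rule tensor_rel_scale_right)

lemma cbilinear_tensor_of: "cbilinear (\<otimes>)"
  by (rule cbilinearI)
     (simp_all add: tensor_add_left tensor_add_right tensor_scaleC_left tensor_scaleC_right)

lemma tensor_induct [case_names tensor add]:
  assumes tensor: "\<And>a b. P (a \<otimes> b)" and add: "\<And>s t. P s \<Longrightarrow> P t \<Longrightarrow> P (s + t)"
  shows "P t"
proof (induction t rule: tensor.abs_induct)
  case (1 p)
  show ?case
  proof (induction p rule: free_induct)
    case (single k c)
    have "abs_tensor (Poly_Mapping.single k c) = (c *\<^sub>C fst k) \<otimes> snd k"
      unfolding tensor_scaleC_left
      by (simp add: tensor_of.abs_eq scaleC_tensor.abs_eq scaleC_single)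
    then show ?case using tensor by simp
  next
    case (add p q)
    then show ?case using assms(2) by (simp add: plus_tensor.abs_eq[symmetric])
  qed
qed

text \<open>
  The linear map on a tensor product that is induced by a bilinear map \<open>\<beta>\<close>.  The definition
  evaluates \<open>\<beta>\<close> on a representative; \<open>tensor_lift_tensor_of\<close> and \<open>clinear_tensor_lift\<close> state
  the universal property.
\<close>

definition tensor_lift ::
  "('a::complex_vector \<Rightarrow> 'b::complex_vector \<Rightarrow> 'c::complex_vector) \<Rightarrow> ('a \<otimes> 'b) \<Rightarrow> 'c"
  where "tensor_lift \<beta> t = lin_ext (\<lambda>(a, b). \<beta> a b) (rep_tensor t)"

lemma tensor_lift_abs:
  assumes "cbilinear \<beta>"
  shows "tensor_lift \<beta> (abs_tensor p) = lin_ext (\<lambda>(a, b). \<beta> a b) p"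
proof -
  have "tensor_rel p q \<Longrightarrow> lin_ext (\<lambda>(a, b). \<beta> a b) p = lin_ext (\<lambda>(a, b). \<beta> a b) q" for p q
    by (induction rule: tensor_rel.induct)
       (use assms in \<open>auto simp: lin_ext_add lin_ext_scaleC cbilinear_def clinear_iff scaleC_one\<close>)
  moreover have "tensor_rel (rep_tensor (abs_tensor p)) p"
    by (simp add: Quotient3_rep_abs[OF Quotient3_tensor] tensor_rel_refl)
  ultimately show ?thesis by (simp add: tensor_lift_def)
qed

lemma tensor_lift_tensor_of:
  assumes "cbilinear \<beta>"
  shows "tensor_lift \<beta> (a \<otimes> b) = \<beta> a b"
  by (simp add: tensor_of.abs_eq tensor_lift_abs[OF assms] scaleC_one)

lemma clinear_tensor_lift:
  assumes "cbilinear \<beta>"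
  shows "clinear (tensor_lift \<beta>)"
proof -
  have "tensor_lift \<beta> (s + t) = tensor_lift \<beta> s + tensor_lift \<beta> t" for s t
    by (induction s rule: tensor.abs_induct; induction t rule: tensor.abs_induct)
       (simp add: plus_tensor.abs_eq tensor_lift_abs[OF assms] lin_ext_add)
  moreover have "tensor_lift \<beta> (c *\<^sub>C t) = c *\<^sub>C tensor_lift \<beta> t" for c t
    by (induction t rule: tensor.abs_induct)
       (simp add: scaleC_tensor.abs_eq tensor_lift_abs[OF assms] lin_ext_scaleC)
  ultimately show ?thesis by (simp add: clinear_iff)
qed

lemma tensor_lift_fun_add:
  "tensor_lift (\<lambda>a b. \<beta> a b + \<gamma> a b) t = tensor_lift \<beta> t + tensor_lift \<gamma> t"
  unfolding tensor_lift_def lin_ext_fun_add[symmetric] by (simp add: case_prod_unfold)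

lemma tensor_lift_fun_scaleC:
  "tensor_lift (\<lambda>a b. c *\<^sub>C \<beta> a b) t = c *\<^sub>C tensor_lift \<beta> t"
  unfolding tensor_lift_def lin_ext_fun_scaleC[symmetric] by (simp add: case_prod_unfold)

definition tensor_map ::
  "('a::complex_vector \<Rightarrow> 'c::complex_vector) \<Rightarrow> ('b::complex_vector \<Rightarrow> 'd::complex_vector)
    \<Rightarrow> ('a \<otimes> 'b) \<Rightarrow> ('c \<otimes> 'd)"
  where "tensor_map f g = tensor_lift (\<lambda>a b. f a \<otimes> g b)"

definition tensor_assoc ::
  "(('a::complex_vector \<otimes> 'b::complex_vector) \<otimes> 'c::complex_vector) \<Rightarrow> ('a \<otimes> ('b \<otimes> 'c))"
  where "tensor_assoc = tensor_lift (\<lambda>t c. tensor_lift (\<lambda>a b. a \<otimes> (b \<otimes> c)) t)"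

instantiation tensor :: (complex_algebra_1, complex_algebra_1) complex_algebra_1
begin

definition one_tensor :: "'a \<otimes> 'b"
  where "one_tensor = 1 \<otimes> 1"

definition times_tensor :: "('a \<otimes> 'b) \<Rightarrow> ('a \<otimes> 'b) \<Rightarrow> ('a \<otimes> 'b)"
  where "times_tensor s t = tensor_lift (\<lambda>a b. tensor_lift (\<lambda>c d. (a * c) \<otimes> (b * d)) t) s"

lemma cbilinear_times_inner:
  "cbilinear (\<lambda>c d. ((a::'a) * c) \<otimes> ((b::'b) * d))"
  by (rule cbilinearI) (simp_all add: algebra_simps mult_scaleC_right tensor_add_left tensor_add_right
      tensor_scaleC_left tensor_scaleC_right)

lemma cbilinear_times_outer:
  "cbilinear (\<lambda>(a::'a) (b::'b). tensor_lift (\<lambda>c d. (a * c) \<otimes> (b * d)) t)"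
  by (rule cbilinearI) (simp_all add: algebra_simps mult_scaleC_left tensor_add_left tensor_add_right
      tensor_scaleC_left tensor_scaleC_right tensor_lift_fun_add tensor_lift_fun_scaleC)

lemma tensor_mult: "((a::'a) \<otimes> (b::'b)) * (c \<otimes> d) = (a * c) \<otimes> (b * d)"
  unfolding times_tensor_def
  by (rule trans[OF tensor_lift_tensor_of[OF cbilinear_times_outer] tensor_lift_tensor_of[OF cbilinear_times_inner]])

lemma tensor_distrib_right: "(s + t) * u = s * u + t * (u::'a \<otimes> 'b)"
  and tensor_scale_left: "(c *\<^sub>C s) * u = c *\<^sub>C (s * u)"
  using clinear_tensor_lift[OF cbilinear_times_outer, of u]
  by (simp_all add: times_tensor_def clinear_iff)

lemma tensor_distrib_left: "s * (t + u) = s * t + s * (u::'a \<otimes> 'b)"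
  and tensor_scale_right: "s * (c *\<^sub>C u) = c *\<^sub>C (s * u)"
proof -
  have lin: "clinear (tensor_lift (\<lambda>c d. ((a::'a) * c) \<otimes> ((b::'b) * d)))" for a b
    by (rule clinear_tensor_lift[OF cbilinear_times_inner])
  show "s * (t + u) = s * t + s * u"
    using lin by (simp add: times_tensor_def clinear_iff tensor_lift_fun_add)
  show "s * (c *\<^sub>C u) = c *\<^sub>C (s * u)"
    using lin by (simp add: times_tensor_def clinear_iff tensor_lift_fun_scaleC)
qed

instance
proof
  fix s t u :: "'a \<otimes> 'b" and c :: complex
  show "(s + t) * u = s * u + t * u" by (rule tensor_distrib_right)
  show "s * (t + u) = s * t + s * u" by (rule tensor_distrib_left)
  show "(c *\<^sub>C s) * t = c *\<^sub>C (s * t)" by (rule tensor_scale_left)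
  show "s * (c *\<^sub>C t) = c *\<^sub>C (s * t)" by (rule tensor_scale_right)
  show "1 * s = s"
    by (induction s rule: tensor_induct) (simp_all add: one_tensor_def tensor_mult tensor_distrib_left)
  show "s * 1 = s"
    by (induction s rule: tensor_induct) (simp_all add: one_tensor_def tensor_mult tensor_distrib_right)
  show "(s * t) * u = s * (t * u)"
  proof (induction s rule: tensor_induct)
    case (tensor a b)
    show ?case
    proof (induction t rule: tensor_induct)
      case (tensor c d)
      show ?case
        by (induction u rule: tensor_induct)
           (simp_all add: tensor_mult tensor_distrib_left mult.assoc)
    qed (simp add: tensor_distrib_left tensor_distrib_right)
  qed (simp add: tensor_distrib_right)
qed

end


section \<open>Hopf algebras and stable anti-Yetter-Drinfeld modules\<close>

locale hopf_algebra =
  fixes \<Delta> :: "'h::complex_algebra_1 \<Rightarrow> 'h \<otimes> 'h"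
    and \<epsilon> :: "'h \<Rightarrow> complex"
    and S :: "'h \<Rightarrow> 'h"
  assumes alg_hom_comult: "alg_hom \<Delta>"
    and alg_hom_counit: "alg_hom \<epsilon>"
    and clinear_antipode: "clinear S"
    and coassociative: "tensor_assoc (tensor_map \<Delta> id (\<Delta> h)) = tensor_map id \<Delta> (\<Delta> h)"
    and counit_left: "tensor_lift (\<lambda>a b. \<epsilon> a *\<^sub>C b) (\<Delta> h) = h"
    and counit_right: "tensor_lift (\<lambda>a b. \<epsilon> b *\<^sub>C a) (\<Delta> h) = h"
    and antipode_left: "tensor_lift (\<lambda>a b. S a * b) (\<Delta> h) = \<epsilon> h *\<^sub>C 1"
    and antipode_right: "tensor_lift (\<lambda>a b. a * S b) (\<Delta> h) = \<epsilon> h *\<^sub>C 1"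

locale right_module =
  fixes act :: "'v::complex_vector \<Rightarrow> 'h::complex_algebra_1 \<Rightarrow> 'v"  (infixl "\<triangleleft>" 70)
  assumes cbilinear_act: "cbilinear (\<triangleleft>)"
    and act_one: "v \<triangleleft> 1 = v"
    and act_mult: "v \<triangleleft> (g * h) = (v \<triangleleft> g) \<triangleleft> h"

locale left_comodule =
  fixes \<Delta> :: "'h::complex_algebra_1 \<Rightarrow> 'h \<otimes> 'h"
    and \<epsilon> :: "'h \<Rightarrow> complex"
    and coact :: "'v::complex_vector \<Rightarrow> 'h \<otimes> 'v"
  assumes clinear_coact: "clinear coact"
    and coact_coassociative:
      "tensor_assoc (tensor_map \<Delta> id (coact v)) = tensor_map id coact (coact v)"
    and coact_counit: "tensor_lift (\<lambda>a w. \<epsilon> a *\<^sub>C w) (coact v) = v"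

text \<open>
  In \<open>anti_yetter_drinfeld\<close> the variables stand for the Sweedler components
  \<open>h1 = h\<^bsub>(1)\<^esub>\<close>, \<open>h2 = h\<^bsub>(2)\<^esub>\<close>, \<open>h3 = h\<^bsub>(3)\<^esub>\<close>, with \<open>k = h\<^bsub>(2)\<^esub>\<close> of the first coproduct,
  and \<open>a\<close>, \<open>w\<close> for the components of degree \<open>-1\<close> and \<open>0\<close> of the coaction.
\<close>

locale right_left_SAYD = hopf_algebra \<Delta> \<epsilon> S + right_module act + left_comodule \<Delta> \<epsilon> coact
  for \<Delta> :: "'h::complex_algebra_1 \<Rightarrow> 'h \<otimes> 'h"
    and \<epsilon> :: "'h \<Rightarrow> complex"
    and S :: "'h \<Rightarrow> 'h"
    and act :: "'v::complex_vector \<Rightarrow> 'h \<Rightarrow> 'v"  (infixl "\<triangleleft>" 70)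
    and coact :: "'v \<Rightarrow> 'h \<otimes> 'v" +
  assumes anti_yetter_drinfeld:
      "coact (v \<triangleleft> h) =
        tensor_lift (\<lambda>h1 k. tensor_lift (\<lambda>h2 h3. tensor_lift (\<lambda>a w. (S h3 * a * h1) \<otimes> (w \<triangleleft> h2))
          (coact v)) (\<Delta> k)) (\<Delta> h)"
    and stable: "tensor_lift (\<lambda>a w. w \<triangleleft> a) (coact v) = v"


section \<open>The Schwarzian Hopf algebra\<close>

text \<open>
  The free monoid, written additively so that \<open>'g free_monoid \<Rightarrow>\<^sub>0 complex\<close> with its convolution
  product is the free associative algebra on \<open>'g\<close>.
\<close>

datatype 'g free_monoid = Word (letters: "'g list")

instantiation free_monoid :: (type) monoid_add
begin

definition zero_free_monoid :: "'a free_monoid"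
  where "zero_free_monoid = Word []"

definition plus_free_monoid :: "'a free_monoid \<Rightarrow> 'a free_monoid \<Rightarrow> 'a free_monoid"
  where "plus_free_monoid u w = Word (letters u @ letters w)"

instance
  by standard (simp_all add: zero_free_monoid_def plus_free_monoid_def)

end

lemma letters_zero [simp]: "letters 0 = []"
  and letters_plus [simp]: "letters (u + w) = letters u @ letters w"
  by (simp_all add: zero_free_monoid_def plus_free_monoid_def)

type_synonym 'g free_algebra = "'g free_monoid \<Rightarrow>\<^sub>0 complex"

definition free_gen :: "'g \<Rightarrow> 'g free_algebra"
  where "free_gen g = Poly_Mapping.single (Word [g]) 1"

lemma scaleC_mult_free: "(c *\<^sub>C p) * q = c *\<^sub>C (p * q)" for p :: "'g free_algebra"
proof (induction p rule: free_induct)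
  case (single u a)
  then show ?case
    by (induction q rule: free_induct)
       (simp_all add: scaleC_single mult_single distrib_left scaleC_add_right mult.assoc)
qed (simp add: distrib_right scaleC_add_right)

lemma mult_scaleC_free: "p * (c *\<^sub>C q) = c *\<^sub>C (p * q)" for p :: "'g free_algebra"
proof (induction p rule: free_induct)
  case (single u a)
  then show ?case
    by (induction q rule: free_induct)
       (simp_all add: scaleC_single mult_single distrib_left scaleC_add_right mult.left_commute)
qed (simp add: distrib_right scaleC_add_right)

datatype schwarzian_gen = Gen_X | Gen_Y | Gen_\<delta>\<^sub>1

inductive schwarzian_rel :: "schwarzian_gen free_algebra \<Rightarrow> schwarzian_gen free_algebra \<Rightarrow> bool"
  where
    schwarzian_rel_refl: "schwarzian_rel p p"
  | schwarzian_rel_sym: "schwarzian_rel p q \<Longrightarrow> schwarzian_rel q p"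
  | schwarzian_rel_trans: "schwarzian_rel p q \<Longrightarrow> schwarzian_rel q r \<Longrightarrow> schwarzian_rel p r"
  | schwarzian_rel_add: "schwarzian_rel p q \<Longrightarrow> schwarzian_rel p' q' \<Longrightarrow> schwarzian_rel (p + p') (q + q')"
  | schwarzian_rel_scale: "schwarzian_rel p q \<Longrightarrow> schwarzian_rel (c *\<^sub>C p) (c *\<^sub>C q)"
  | schwarzian_rel_mult: "schwarzian_rel p q \<Longrightarrow> schwarzian_rel p' q' \<Longrightarrow> schwarzian_rel (p * p') (q * q')"
  | schwarzian_rel_Y_X: "schwarzian_rel (free_gen Gen_Y * free_gen Gen_X - free_gen Gen_X * free_gen Gen_Y)
      (free_gen Gen_X)"
  | schwarzian_rel_Y_\<delta>\<^sub>1: "schwarzian_rel (free_gen Gen_Y * free_gen Gen_\<delta>\<^sub>1 - free_gen Gen_\<delta>\<^sub>1 * free_gen Gen_Y)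
      (free_gen Gen_\<delta>\<^sub>1)"
  | schwarzian_rel_X_\<delta>\<^sub>1: "schwarzian_rel (free_gen Gen_X * free_gen Gen_\<delta>\<^sub>1 - free_gen Gen_\<delta>\<^sub>1 * free_gen Gen_X)
      ((1/2) *\<^sub>C (free_gen Gen_\<delta>\<^sub>1 ^ 2))"

quotient_type schwarzian = "schwarzian_gen free_algebra" / schwarzian_rel
  by (auto intro!: equivpI reflpI sympI transpI
      intro: schwarzian_rel_refl schwarzian_rel_sym schwarzian_rel_trans)

lemma schwarzian_rel_uminus: "schwarzian_rel p q \<Longrightarrow> schwarzian_rel (- p) (- q)"
  using schwarzian_rel_scale[of p q "- 1"] by (simp add: scaleC_one)

instantiation schwarzian :: complex_algebra_1
begin

lift_definition zero_schwarzian :: schwarzian is 0 .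

lift_definition one_schwarzian :: schwarzian is 1 .

lift_definition plus_schwarzian :: "schwarzian \<Rightarrow> schwarzian \<Rightarrow> schwarzian" is "(+)"
  by (rule schwarzian_rel_add)

lift_definition uminus_schwarzian :: "schwarzian \<Rightarrow> schwarzian" is uminus
  by (rule schwarzian_rel_uminus)

lift_definition minus_schwarzian :: "schwarzian \<Rightarrow> schwarzian \<Rightarrow> schwarzian" is "(-)"
  using schwarzian_rel_add schwarzian_rel_uminus by fastforce

lift_definition times_schwarzian :: "schwarzian \<Rightarrow> schwarzian \<Rightarrow> schwarzian" is "(*)"
  by (rule schwarzian_rel_mult)

lift_definition scaleC_schwarzian :: "complex \<Rightarrow> schwarzian \<Rightarrow> schwarzian" is scaleC
  by (rule schwarzian_rel_scale)

instance
proof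
  fix x y z :: schwarzian and c d :: complex
  show "x + y + z = x + (y + z)" by transfer (simp add: schwarzian_rel_refl add.assoc)
  show "x + y = y + x" by transfer (simp add: schwarzian_rel_refl add.commute)
  show "0 + x = x" by transfer (simp add: schwarzian_rel_refl)
  show "- x + x = 0" by transfer (simp add: schwarzian_rel_refl)
  show "x - y = x + - y" by transfer (simp add: schwarzian_rel_refl)
  show "x * y * z = x * (y * z)" by transfer (simp add: schwarzian_rel_refl mult.assoc)
  show "1 * x = x" by transfer (simp add: schwarzian_rel_refl)
  show "x * 1 = x" by transfer (simp add: schwarzian_rel_refl)
  show "(x + y) * z = x * z + y * z" by transfer (simp add: schwarzian_rel_refl distrib_right)
  show "x * (y + z) = x * y + x * z" by transfer (simp add: schwarzian_rel_refl distrib_left)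
  show "c *\<^sub>C (x + y) = c *\<^sub>C x + c *\<^sub>C y" by transfer (simp add: schwarzian_rel_refl scaleC_add_right)
  show "(c + d) *\<^sub>C x = c *\<^sub>C x + d *\<^sub>C x" by transfer (simp add: schwarzian_rel_refl scaleC_add_left)
  show "c *\<^sub>C d *\<^sub>C x = (c * d) *\<^sub>C x" by transfer (simp add: schwarzian_rel_refl scaleC_scaleC)
  show "1 *\<^sub>C x = x" by transfer (simp add: schwarzian_rel_refl scaleC_one)
  show "(c *\<^sub>C x) * y = c *\<^sub>C (x * y)"
    by transfer (simp add: schwarzian_rel_refl scaleC_mult_free)
  show "x * (c *\<^sub>C y) = c *\<^sub>C (x * y)"
    by transfer (simp add: schwarzian_rel_refl mult_scaleC_free)
qed

end

lift_definition X :: schwarzian is "free_gen Gen_X" .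
lift_definition Y :: schwarzian is "free_gen Gen_Y" .
lift_definition \<delta>\<^sub>1 :: schwarzian is "free_gen Gen_\<delta>\<^sub>1" .

lemma schwarzian_relations:
  "Y * X - X * Y = X" "Y * \<delta>\<^sub>1 - \<delta>\<^sub>1 * Y = \<delta>\<^sub>1" "X * \<delta>\<^sub>1 - \<delta>\<^sub>1 * X = (1/2) *\<^sub>C (\<delta>\<^sub>1 ^ 2)"
  unfolding power2_eq_square
  by (transfer, use schwarzian_rel.intros(7-9) in \<open>simp add: power2_eq_square\<close>)+


subsection \<open>Maps out of presented algebras\<close>

definition free_hom :: "('g \<Rightarrow> 'a::complex_algebra_1) \<Rightarrow> 'g free_algebra \<Rightarrow> 'a"
  where "free_hom f = lin_ext (\<lambda>w. prod_list (map f (letters w)))"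

definition free_antihom :: "('g \<Rightarrow> 'a::complex_algebra_1) \<Rightarrow> 'g free_algebra \<Rightarrow> 'a"
  where "free_antihom f = lin_ext (\<lambda>w. prod_list (map f (rev (letters w))))"

definition free_act :: "('v::complex_vector \<Rightarrow> 'g \<Rightarrow> 'v) \<Rightarrow> 'v \<Rightarrow> 'g free_algebra \<Rightarrow> 'v"
  where "free_act \<phi> v = lin_ext (\<lambda>w. foldl \<phi> v (letters w))"

lemma free_hom_gen [simp]: "free_hom f (free_gen g) = f g"
  by (simp add: free_hom_def free_gen_def scaleC_one)

lemma free_antihom_gen [simp]: "free_antihom f (free_gen g) = f g"
  by (simp add: free_antihom_def free_gen_def scaleC_one)

lemma free_act_gen [simp]: "free_act \<phi> v (free_gen g) = \<phi> v g"
  by (simp add: free_act_def free_gen_def scaleC_one)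

lemma free_hom_mult: "free_hom f (p * q) = free_hom f p * free_hom f q"
proof (induction p rule: free_induct)
  case (single u a)
  then show ?case
    by (induction q rule: free_induct)
       (simp_all add: free_hom_def mult_single lin_ext_add distrib_left mult_scaleC_left
         mult_scaleC_right scaleC_scaleC)
qed (simp add: free_hom_def distrib_right lin_ext_add)

lemma free_antihom_mult: "free_antihom f (p * q) = free_antihom f q * free_antihom f p"
proof (induction p rule: free_induct)
  case (single u a)
  then show ?case
    by (induction q rule: free_induct)
       (simp_all add: free_antihom_def mult_single lin_ext_add distrib_left distrib_right
         mult_scaleC_left mult_scaleC_right scaleC_scaleC scaleC_add_right mult.commute[of a])
qed (simp add: free_antihom_def distrib_left distrib_right lin_ext_add)

lemma free_act_linear:
  assumes "\<And>g. clinear (\<lambda>v. \<phi> v g)"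
  shows "clinear (\<lambda>v. free_act \<phi> v p)"
proof -
  have "clinear (\<lambda>v. foldl \<phi> v gs)" for gs
    using assms by (induction gs rule: rev_induct) (simp_all add: clinear_iff)
  then show ?thesis
    by (simp add: clinear_iff free_act_def lin_ext_fun_add lin_ext_fun_scaleC)
qed

lemma free_act_mult:
  assumes "\<And>g. clinear (\<lambda>v. \<phi> v g)"
  shows "free_act \<phi> v (p * q) = free_act \<phi> (free_act \<phi> v p) q"
proof (induction p rule: free_induct)
  case (single u a)
  have lin: "free_act \<phi> (a *\<^sub>C x) q = a *\<^sub>C free_act \<phi> x q" for x q
    using free_act_linear[of \<phi> q, OF assms] by (simp add: clinear_iff)
  have "free_act \<phi> v (Poly_Mapping.single u a * q) = a *\<^sub>C free_act \<phi> (foldl \<phi> v (letters u)) q"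
    by (induction q rule: free_induct)
       (simp_all add: free_act_def mult_single lin_ext_add distrib_left scaleC_scaleC
         scaleC_add_right)
  also have "\<dots> = free_act \<phi> (free_act \<phi> v (Poly_Mapping.single u a)) q"
    unfolding lin[symmetric] by (simp add: free_act_def)
  finally show ?case .
next
  case (add p p')
  have "free_act \<phi> (x + y) q = free_act \<phi> x q + free_act \<phi> y q" for x y
    using free_act_linear[of \<phi> q, OF assms] by (simp add: clinear_iff)
  with add show ?case
    by (simp add: distrib_right free_act_def[of \<phi> v] lin_ext_add)
qed

lemma schwarzian_rel_free_hom:
  assumes "schwarzian_rel p q"
    and "f Gen_Y * f Gen_X - f Gen_X * f Gen_Y = f Gen_X"
    and "f Gen_Y * f Gen_\<delta>\<^sub>1 - f Gen_\<delta>\<^sub>1 * f Gen_Y = f Gen_\<delta>\<^sub>1"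
    and "f Gen_X * f Gen_\<delta>\<^sub>1 - f Gen_\<delta>\<^sub>1 * f Gen_X = (1/2) *\<^sub>C (f Gen_\<delta>\<^sub>1 ^ 2)"
  shows "free_hom f p = free_hom f q"
proof -
  have [simp]: "free_hom f (p + q) = free_hom f p + free_hom f q"
    "free_hom f (p - q) = free_hom f p - free_hom f q"
    "free_hom f (c *\<^sub>C p) = c *\<^sub>C free_hom f p" for p q c
    by (simp_all add: free_hom_def lin_ext_add lin_ext_diff lin_ext_scaleC)
  show ?thesis
    using assms(1)
    by induction (use assms(2-4) in \<open>simp_all add: free_hom_mult power2_eq_square\<close>)
qed

lemma schwarzian_rel_free_antihom:
  assumes "schwarzian_rel p q"
    and "f Gen_X * f Gen_Y - f Gen_Y * f Gen_X = f Gen_X"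
    and "f Gen_\<delta>\<^sub>1 * f Gen_Y - f Gen_Y * f Gen_\<delta>\<^sub>1 = f Gen_\<delta>\<^sub>1"
    and "f Gen_\<delta>\<^sub>1 * f Gen_X - f Gen_X * f Gen_\<delta>\<^sub>1 = (1/2) *\<^sub>C (f Gen_\<delta>\<^sub>1 ^ 2)"
  shows "free_antihom f p = free_antihom f q"
proof -
  have [simp]: "free_antihom f (p + q) = free_antihom f p + free_antihom f q"
    "free_antihom f (p - q) = free_antihom f p - free_antihom f q"
    "free_antihom f (c *\<^sub>C p) = c *\<^sub>C free_antihom f p" for p q c
    by (simp_all add: free_antihom_def lin_ext_add lin_ext_diff lin_ext_scaleC)
  show ?thesis
    using assms(1)
    by induction (use assms(2-4) in \<open>simp_all add: free_antihom_mult power2_eq_square\<close>)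
qed

lemma schwarzian_rel_free_act:
  assumes "schwarzian_rel p q"
    and lin: "\<And>g. clinear (\<lambda>v. \<phi> v g)"
    and "\<And>v. \<phi> (\<phi> v Gen_Y) Gen_X - \<phi> (\<phi> v Gen_X) Gen_Y = \<phi> v Gen_X"
    and "\<And>v. \<phi> (\<phi> v Gen_Y) Gen_\<delta>\<^sub>1 - \<phi> (\<phi> v Gen_\<delta>\<^sub>1) Gen_Y = \<phi> v Gen_\<delta>\<^sub>1"
    and "\<And>v. \<phi> (\<phi> v Gen_X) Gen_\<delta>\<^sub>1 - \<phi> (\<phi> v Gen_\<delta>\<^sub>1) Gen_X
      = (1/2) *\<^sub>C \<phi> (\<phi> v Gen_\<delta>\<^sub>1) Gen_\<delta>\<^sub>1"
  shows "free_act \<phi> v p = free_act \<phi> v q"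
proof -
  have [simp]: "free_act \<phi> v (p + q) = free_act \<phi> v p + free_act \<phi> v q"
    "free_act \<phi> v (p - q) = free_act \<phi> v p - free_act \<phi> v q"
    "free_act \<phi> v (c *\<^sub>C p) = c *\<^sub>C free_act \<phi> v p" for v p q c
    by (simp_all add: free_act_def lin_ext_add lin_ext_diff lin_ext_scaleC)
  show ?thesis
    using assms(1)
    by (induction arbitrary: v)
       (use assms(3-5) in \<open>simp_all add: free_act_mult[OF lin] power2_eq_square\<close>)
qed


subsection \<open>The Hopf algebra structure\<close>

fun comult_gen :: "schwarzian_gen \<Rightarrow> schwarzian \<otimes> schwarzian"
  where
    "comult_gen Gen_X = X \<otimes> 1 + 1 \<otimes> X + Y \<otimes> \<delta>\<^sub>1"
  | "comult_gen Gen_Y = Y \<otimes> 1 + 1 \<otimes> Y"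
  | "comult_gen Gen_\<delta>\<^sub>1 = \<delta>\<^sub>1 \<otimes> 1 + 1 \<otimes> \<delta>\<^sub>1"

fun antipode_gen :: "schwarzian_gen \<Rightarrow> schwarzian"
  where
    "antipode_gen Gen_X = - X + Y * \<delta>\<^sub>1"
  | "antipode_gen Gen_Y = - Y"
  | "antipode_gen Gen_\<delta>\<^sub>1 = - \<delta>\<^sub>1"

lemma tensor_minus_left: "(- a) \<otimes> b = - (a \<otimes> b)"
  using tensor_scaleC_left[of "- 1" a b] by (simp add: scaleC_one)

lemma tensor_minus_right: "a \<otimes> (- b) = - (a \<otimes> b)"
  using tensor_scaleC_right[of a "- 1" b] by (simp add: scaleC_one)

lemma tensor_diff_left: "(a - a') \<otimes> b = a \<otimes> b - a' \<otimes> b"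
  using tensor_add_left[of a "- a'" b] by (simp add: tensor_minus_left)

lemma tensor_diff_right: "a \<otimes> (b - b') = a \<otimes> b - a \<otimes> b'"
  using tensor_add_right[of a b "- b'"] by (simp add: tensor_minus_right)

lemma schwarzian_commute:
  "Y * X = X * Y + X" "Y * \<delta>\<^sub>1 = \<delta>\<^sub>1 * Y + \<delta>\<^sub>1" "X * \<delta>\<^sub>1 = \<delta>\<^sub>1 * X + (1/2) *\<^sub>C (\<delta>\<^sub>1 * \<delta>\<^sub>1)"
  using schwarzian_relations by (simp_all add: algebra_simps power2_eq_square)

lemma schwarzian_commute_left:
  "Y * (X * z) = X * (Y * z) + X * z" "Y * (\<delta>\<^sub>1 * z) = \<delta>\<^sub>1 * (Y * z) + \<delta>\<^sub>1 * z"
  "X * (\<delta>\<^sub>1 * z) = \<delta>\<^sub>1 * (X * z) + (1/2) *\<^sub>C (\<delta>\<^sub>1 * (\<delta>\<^sub>1 * z))"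
  by (simp_all add: mult.assoc[symmetric] schwarzian_commute distrib_right mult_scaleC_left)

lemma scaleC_half_add: "(1/2) *\<^sub>C x + (1/2) *\<^sub>C x = x"
  by (simp add: scaleC_add_left[symmetric] scaleC_one)

lift_definition comult :: "schwarzian \<Rightarrow> schwarzian \<otimes> schwarzian" is "free_hom comult_gen"
proof (erule schwarzian_rel_free_hom)
  show "comult_gen Gen_Y * comult_gen Gen_X - comult_gen Gen_X * comult_gen Gen_Y = comult_gen Gen_X"
    by (simp add: distrib_left distrib_right tensor_mult tensor_add_left tensor_add_right
        schwarzian_commute)
  show "comult_gen Gen_Y * comult_gen Gen_\<delta>\<^sub>1 - comult_gen Gen_\<delta>\<^sub>1 * comult_gen Gen_Y = comult_gen Gen_\<delta>\<^sub>1"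
    by (simp add: distrib_left distrib_right tensor_mult tensor_add_left tensor_add_right
        schwarzian_commute)
  have "(1/2) *\<^sub>C (comult_gen Gen_\<delta>\<^sub>1 ^ 2) =
      (1/2) *\<^sub>C ((\<delta>\<^sub>1 * \<delta>\<^sub>1) \<otimes> 1) + (1/2) *\<^sub>C (1 \<otimes> (\<delta>\<^sub>1 * \<delta>\<^sub>1)) + \<delta>\<^sub>1 \<otimes> \<delta>\<^sub>1"
    using scaleC_half_add[of "\<delta>\<^sub>1 \<otimes> \<delta>\<^sub>1"]
    by (simp add: power2_eq_square distrib_left distrib_right tensor_mult scaleC_add_right algebra_simps)
  then show "comult_gen Gen_X * comult_gen Gen_\<delta>\<^sub>1 - comult_gen Gen_\<delta>\<^sub>1 * comult_gen Gen_X
      = (1/2) *\<^sub>C (comult_gen Gen_\<delta>\<^sub>1 ^ 2)"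
    by (simp add: distrib_left distrib_right tensor_mult tensor_add_left tensor_add_right
        tensor_scaleC_left tensor_scaleC_right schwarzian_commute)
qed

lift_definition counit :: "schwarzian \<Rightarrow> complex" is "free_hom (\<lambda>_. 0)"
  by (erule schwarzian_rel_free_hom) simp_all

lift_definition antipode :: "schwarzian \<Rightarrow> schwarzian" is "free_antihom antipode_gen"
proof (erule schwarzian_rel_free_antihom)
  show "antipode_gen Gen_X * antipode_gen Gen_Y - antipode_gen Gen_Y * antipode_gen Gen_X = antipode_gen Gen_X"
    by (simp add: algebra_simps schwarzian_commute schwarzian_commute_left)
  show "antipode_gen Gen_\<delta>\<^sub>1 * antipode_gen Gen_Y - antipode_gen Gen_Y * antipode_gen Gen_\<delta>\<^sub>1 = antipode_gen Gen_\<delta>\<^sub>1"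
    by (simp add: algebra_simps schwarzian_commute schwarzian_commute_left)
  have "\<delta>\<^sub>1 * (Y * \<delta>\<^sub>1) + \<delta>\<^sub>1 * \<delta>\<^sub>1 = Y * \<delta>\<^sub>1 * \<delta>\<^sub>1"
    by (simp add: schwarzian_commute algebra_simps)
  moreover have "(1/2) *\<^sub>C (\<delta>\<^sub>1 * \<delta>\<^sub>1) + (1/2) *\<^sub>C (\<delta>\<^sub>1 * \<delta>\<^sub>1) = \<delta>\<^sub>1 * \<delta>\<^sub>1"
    by (rule scaleC_half_add)
  ultimately show "antipode_gen Gen_\<delta>\<^sub>1 * antipode_gen Gen_X - antipode_gen Gen_X * antipode_gen Gen_\<delta>\<^sub>1
      = (1/2) *\<^sub>C (antipode_gen Gen_\<delta>\<^sub>1 ^ 2)"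
    by (simp add: algebra_simps power2_eq_square schwarzian_commute)
qed

lemma comult_simps:
  "comult X = X \<otimes> 1 + 1 \<otimes> X + Y \<otimes> \<delta>\<^sub>1"
  "comult Y = Y \<otimes> 1 + 1 \<otimes> Y"
  "comult \<delta>\<^sub>1 = \<delta>\<^sub>1 \<otimes> 1 + 1 \<otimes> \<delta>\<^sub>1"
  by (simp_all add: X.abs_eq Y.abs_eq \<delta>\<^sub>1.abs_eq comult.abs_eq)

lemma counit_simps: "counit X = 0" "counit Y = 0" "counit \<delta>\<^sub>1 = 0"
  by (simp_all add: X.abs_eq Y.abs_eq \<delta>\<^sub>1.abs_eq counit.abs_eq)

lemma antipode_simps: "antipode X = - X + Y * \<delta>\<^sub>1" "antipode Y = - Y" "antipode \<delta>\<^sub>1 = - \<delta>\<^sub>1"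
  by (simp_all add: X.abs_eq Y.abs_eq \<delta>\<^sub>1.abs_eq antipode.abs_eq)


section \<open>The module\<close>

datatype sl2_basis = sl2_X | sl2_Y | sl2_Z

text \<open>
  The symmetric algebra of the dual of \<open>sl(2)\<close> is the polynomial algebra in the dual basis;
  its truncation above degree 1 is represented by the polynomials of degree at most 1.
\<close>

typedef sym_sl2_dual_1 =
  "{p :: (sl2_basis \<Rightarrow>\<^sub>0 nat) \<Rightarrow>\<^sub>0 complex.
      \<forall>m\<in>Poly_Mapping.keys p. (\<Sum>i\<in>Poly_Mapping.keys m. Poly_Mapping.lookup m i) \<le> 1}"
  by (rule exI[of _ 0]) simp

setup_lifting type_definition_sym_sl2_dual_1

instantiation sym_sl2_dual_1 :: complex_vector
begin

lift_definition zero_sym_sl2_dual_1 :: sym_sl2_dual_1 is 0 by simp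

lift_definition plus_sym_sl2_dual_1 :: "sym_sl2_dual_1 \<Rightarrow> sym_sl2_dual_1 \<Rightarrow> sym_sl2_dual_1" is "(+)"
  by (meson Poly_Mapping.keys_add UnE subsetD)

lemma keys_diff_subset:
  "Poly_Mapping.keys (p - q) \<subseteq> Poly_Mapping.keys p \<union> Poly_Mapping.keys q"
  for p q :: "'k \<Rightarrow>\<^sub>0 complex"
  by (auto simp: in_keys_iff lookup_minus)

lemma keys_scaleC_subset: "Poly_Mapping.keys (c *\<^sub>C p) \<subseteq> Poly_Mapping.keys p"
  for p :: "'k \<Rightarrow>\<^sub>0 complex"
  by (auto simp: in_keys_iff)

lemma keys_uminus_subset: "Poly_Mapping.keys (- p) \<subseteq> Poly_Mapping.keys p"
  for p :: "'k \<Rightarrow>\<^sub>0 complex"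
  by (auto simp: in_keys_iff)

lift_definition uminus_sym_sl2_dual_1 :: "sym_sl2_dual_1 \<Rightarrow> sym_sl2_dual_1" is uminus
  by (meson keys_uminus_subset subsetD)

lift_definition minus_sym_sl2_dual_1 :: "sym_sl2_dual_1 \<Rightarrow> sym_sl2_dual_1 \<Rightarrow> sym_sl2_dual_1" is "(-)"
  by (meson keys_diff_subset UnE subsetD)

lift_definition scaleC_sym_sl2_dual_1 :: "complex \<Rightarrow> sym_sl2_dual_1 \<Rightarrow> sym_sl2_dual_1" is scaleC
  by (meson keys_scaleC_subset subsetD)

instance
  by standard
     (simp_all add: Rep_sym_sl2_dual_1_inject[symmetric] zero_sym_sl2_dual_1.rep_eq
       plus_sym_sl2_dual_1.rep_eq uminus_sym_sl2_dual_1.rep_eq minus_sym_sl2_dual_1.rep_eq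
       scaleC_sym_sl2_dual_1.rep_eq scaleC_add_right scaleC_add_left scaleC_scaleC scaleC_one
       add.assoc add.commute)

end

lift_definition sym_one :: sym_sl2_dual_1 is "Poly_Mapping.single 0 1"
  by simp

lift_definition sym_dual :: "sl2_basis \<Rightarrow> sym_sl2_dual_1"
  is "\<lambda>i. Poly_Mapping.single (Poly_Mapping.single i 1) 1"
  by simp

lemma single_Suc_0_eq:
  "Poly_Mapping.single i (Suc 0) \<noteq> 0" "0 \<noteq> Poly_Mapping.single i (Suc 0)"
  "Poly_Mapping.single i (Suc 0) = Poly_Mapping.single j (Suc 0) \<longleftrightarrow> i = j"
  by (metis lookup_single_eq lookup_zero nat.distinct(1), metis lookup_single_eq lookup_zero nat.distinct(1),
      metis lookup_single_eq lookup_single_not_eq nat.distinct(1))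

definition sym_coeff :: "sym_sl2_dual_1 \<Rightarrow> (sl2_basis \<Rightarrow>\<^sub>0 nat) \<Rightarrow> complex"
  where "sym_coeff p = Poly_Mapping.lookup (Rep_sym_sl2_dual_1 p)"

text \<open>The second factor is the underlying vector space of \<open>\<complex>\<^sub>\<delta>\<close>.\<close>

type_synonym V\<delta> = "sym_sl2_dual_1 \<otimes> complex"

definition V1 :: V\<delta>  ("\<^bold>1")
  where "\<^bold>1 = sym_one \<otimes> 1"

definition RX :: V\<delta>  ("\<^bold>R\<^sup>X")
  where "\<^bold>R\<^sup>X = sym_dual sl2_X \<otimes> 1"

definition RY :: V\<delta>  ("\<^bold>R\<^sup>Y")
  where "\<^bold>R\<^sup>Y = sym_dual sl2_Y \<otimes> 1"

definition RZ :: V\<delta>  ("\<^bold>R\<^sup>Z")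
  where "\<^bold>R\<^sup>Z = sym_dual sl2_Z \<otimes> 1"

text \<open>The linear map with prescribed values on \<open>\<^bold>1\<close>, \<open>\<^bold>R\<^sup>X\<close>, \<open>\<^bold>R\<^sup>Y\<close>, \<open>\<^bold>R\<^sup>Z\<close>.\<close>

definition V\<delta>_lin :: "'w::complex_vector \<Rightarrow> 'w \<Rightarrow> 'w \<Rightarrow> 'w \<Rightarrow> V\<delta> \<Rightarrow> 'w"
  where "V\<delta>_lin a x y z = tensor_lift (\<lambda>p c. c *\<^sub>C
    (sym_coeff p 0 *\<^sub>C a + sym_coeff p (Poly_Mapping.single sl2_X 1) *\<^sub>C x
      + sym_coeff p (Poly_Mapping.single sl2_Y 1) *\<^sub>C y
      + sym_coeff p (Poly_Mapping.single sl2_Z 1) *\<^sub>C z))"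

lemma cbilinear_V\<delta>_lin:
  "cbilinear (\<lambda>p c. c *\<^sub>C
    (sym_coeff p 0 *\<^sub>C a + sym_coeff p (Poly_Mapping.single sl2_X 1) *\<^sub>C x
      + sym_coeff p (Poly_Mapping.single sl2_Y 1) *\<^sub>C y
      + sym_coeff p (Poly_Mapping.single sl2_Z 1) *\<^sub>C z))"
proof -
  have "sym_coeff (p + q) m = sym_coeff p m + sym_coeff q m"
    "sym_coeff (c *\<^sub>C p) m = c * sym_coeff p m" for p q m c
    by (simp_all add: sym_coeff_def plus_sym_sl2_dual_1.rep_eq scaleC_sym_sl2_dual_1.rep_eq lookup_add)
  then show ?thesis
    by (intro cbilinearI)
       (simp_all add: scaleC_add_left scaleC_add_right scaleC_scaleC algebra_simps)
qed

lemma clinear_V\<delta>_lin: "clinear (V\<delta>_lin a x y z)"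
  unfolding V\<delta>_lin_def by (rule clinear_tensor_lift[OF cbilinear_V\<delta>_lin])

lemma V\<delta>_lin_basis [simp]:
  "V\<delta>_lin a x y z \<^bold>1 = a" "V\<delta>_lin a x y z \<^bold>R\<^sup>X = x" "V\<delta>_lin a x y z \<^bold>R\<^sup>Y = y" "V\<delta>_lin a x y z \<^bold>R\<^sup>Z = z"
proof -
  have "sym_coeff sym_one 0 = 1" "sym_coeff sym_one (Poly_Mapping.single i 1) = 0"
    "sym_coeff (sym_dual i) 0 = 0"
    "sym_coeff (sym_dual i) (Poly_Mapping.single j 1) = (if i = j then 1 else 0)" for i j
    by (auto simp: sym_coeff_def sym_one.rep_eq sym_dual.rep_eq lookup_single lookup_one when_def
        single_Suc_0_eq)
  then show "V\<delta>_lin a x y z \<^bold>1 = a" "V\<delta>_lin a x y z \<^bold>R\<^sup>X = x"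
    "V\<delta>_lin a x y z \<^bold>R\<^sup>Y = y" "V\<delta>_lin a x y z \<^bold>R\<^sup>Z = z"
    unfolding V\<delta>_lin_def V1_def RX_def RY_def RZ_def tensor_lift_tensor_of[OF cbilinear_V\<delta>_lin]
    by (simp_all add: scaleC_one)
qed

lemmas sym_simps = sym_coeff_def sym_one.rep_eq sym_dual.rep_eq plus_sym_sl2_dual_1.rep_eq
  scaleC_sym_sl2_dual_1.rep_eq

lemma V\<delta>_expand: "V\<delta>_lin \<^bold>1 \<^bold>R\<^sup>X \<^bold>R\<^sup>Y \<^bold>R\<^sup>Z v = v"
proof (induction v rule: tensor_induct)
  case (tensor p c)
  have deg: "m = 0 \<or> (\<exists>i. m = Poly_Mapping.single i 1)"
    if m: "(\<Sum>i\<in>Poly_Mapping.keys m. Poly_Mapping.lookup m i) \<le> 1" for m :: "sl2_basis \<Rightarrow>\<^sub>0 nat"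
  proof (cases "m = 0")
    case False
    then obtain i where i: "i \<in> Poly_Mapping.keys m"
      by (metis poly_mapping_eqI in_keys_iff lookup_zero)
    have "Poly_Mapping.lookup m j = (if j = i then 1 else 0)" for j
    proof -
      have "(\<Sum>i\<in>Poly_Mapping.keys m. Poly_Mapping.lookup m i)
        = Poly_Mapping.lookup m i + (\<Sum>k\<in>Poly_Mapping.keys m - {i}. Poly_Mapping.lookup m k)"
        using i by (simp add: sum.remove)
      moreover have "Poly_Mapping.lookup m i \<ge> 1" using i by (simp add: in_keys_iff)
      ultimately have "Poly_Mapping.lookup m i = 1"
        "(\<Sum>k\<in>Poly_Mapping.keys m - {i}. Poly_Mapping.lookup m k) = 0"
        using m by linarith+
      then show ?thesis by (cases "j = i") (auto simp: in_keys_iff)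
    qed
    then have "m = Poly_Mapping.single i 1"
      by (intro poly_mapping_eqI) (simp add: lookup_single when_def)
    then show ?thesis by blast
  qed simp
  have "p = sym_coeff p 0 *\<^sub>C sym_one + sym_coeff p (Poly_Mapping.single sl2_X 1) *\<^sub>C sym_dual sl2_X
      + sym_coeff p (Poly_Mapping.single sl2_Y 1) *\<^sub>C sym_dual sl2_Y
      + sym_coeff p (Poly_Mapping.single sl2_Z 1) *\<^sub>C sym_dual sl2_Z" (is "_ = ?q")
  proof -
    have "Poly_Mapping.lookup (Rep_sym_sl2_dual_1 p) m = Poly_Mapping.lookup (Rep_sym_sl2_dual_1 ?q) m" for m
    proof (cases "m = 0 \<or> (\<exists>i. m = Poly_Mapping.single i 1)")
      case True
      then show ?thesis
      proof
        assume "\<exists>i. m = Poly_Mapping.single i 1"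
        then obtain i where "m = Poly_Mapping.single i 1" by blast
        then show ?thesis
          by (cases i) (simp_all add: sym_simps lookup_add lookup_single lookup_one when_def single_Suc_0_eq)
      qed (simp add: sym_simps lookup_add lookup_single lookup_one when_def single_Suc_0_eq)
    next
      case False
      then have "m \<notin> Poly_Mapping.keys (Rep_sym_sl2_dual_1 p)"
        using Rep_sym_sl2_dual_1[of p] deg by blast
      then have "Poly_Mapping.lookup (Rep_sym_sl2_dual_1 p) m = 0" by (simp add: in_keys_iff)
      with False show ?thesis by (auto simp: sym_simps lookup_add lookup_single lookup_one when_def single_Suc_0_eq)
    qed
    then show ?thesis
      by (simp add: Rep_sym_sl2_dual_1_inject[symmetric] poly_mapping_eqI)
  qed
  then have "p \<otimes> c = c *\<^sub>C (?q \<otimes> 1)"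
    using tensor_scaleC_right[of p c "1::complex"] by simp
  also have "\<dots> = V\<delta>_lin \<^bold>1 \<^bold>R\<^sup>X \<^bold>R\<^sup>Y \<^bold>R\<^sup>Z (p \<otimes> c)"
    unfolding V\<delta>_lin_def tensor_lift_tensor_of[OF cbilinear_V\<delta>_lin] V1_def RX_def RY_def RZ_def
      tensor_add_left tensor_scaleC_left ..
  finally show ?case ..
next
  case (add s t)
  then show ?case using clinear_V\<delta>_lin[of "\<^bold>1" "\<^bold>R\<^sup>X" "\<^bold>R\<^sup>Y" "\<^bold>R\<^sup>Z"] by (simp add: clinear_iff)
qed

lemma V\<delta>_eqI:
  assumes f: "clinear f" and g: "clinear g"
    and "f \<^bold>1 = g \<^bold>1" "f \<^bold>R\<^sup>X = g \<^bold>R\<^sup>X" "f \<^bold>R\<^sup>Y = g \<^bold>R\<^sup>Y" "f \<^bold>R\<^sup>Z = g \<^bold>R\<^sup>Z"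
  shows "f v = g v"
proof -
  have "h (V\<delta>_lin \<^bold>1 \<^bold>R\<^sup>X \<^bold>R\<^sup>Y \<^bold>R\<^sup>Z v) = V\<delta>_lin (h \<^bold>1) (h \<^bold>R\<^sup>X) (h \<^bold>R\<^sup>Y) (h \<^bold>R\<^sup>Z) v"
    if h: "clinear h" for h :: "V\<delta> \<Rightarrow> 'a"
  proof (induction v rule: tensor_induct)
    case (tensor p c)
    then show ?case
      unfolding V\<delta>_lin_def tensor_lift_tensor_of[OF cbilinear_V\<delta>_lin]
      using h by (simp add: clinear_iff)
  next
    case (add s t)
    then show ?case
      using h clinear_V\<delta>_lin[of "\<^bold>1" "\<^bold>R\<^sup>X" "\<^bold>R\<^sup>Y" "\<^bold>R\<^sup>Z"]
        clinear_V\<delta>_lin[of "h \<^bold>1" "h \<^bold>R\<^sup>X" "h \<^bold>R\<^sup>Y" "h \<^bold>R\<^sup>Z"]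
      by (simp add: clinear_iff)
  qed
  from this[OF f] this[OF g] assms(3-6) show ?thesis
    by (simp add: V\<delta>_expand)
qed

fun V\<delta>_act_gen :: "V\<delta> \<Rightarrow> schwarzian_gen \<Rightarrow> V\<delta>"
  where
    "V\<delta>_act_gen v Gen_X = V\<delta>_lin 0 (- \<^bold>R\<^sup>Y) (- \<^bold>R\<^sup>Z) 0 v"
  | "V\<delta>_act_gen v Gen_Y = V\<delta>_lin \<^bold>1 (2 *\<^sub>C \<^bold>R\<^sup>X) \<^bold>R\<^sup>Y 0 v"
  | "V\<delta>_act_gen v Gen_\<delta>\<^sub>1 = V\<delta>_lin \<^bold>R\<^sup>Z 0 0 0 v"

lemma clinear_V\<delta>_act_gen: "clinear (\<lambda>v. V\<delta>_act_gen v g)"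
  by (cases g) (simp_all add: clinear_V\<delta>_lin)

lift_definition V\<delta>_act :: "V\<delta> \<Rightarrow> schwarzian \<Rightarrow> V\<delta>"  (infixl "\<triangleleft>" 70) is "free_act V\<delta>_act_gen"
proof (erule schwarzian_rel_free_act)
  note lin = clinear_V\<delta>_act_gen[unfolded clinear_iff, rule_format]
  have [simp]: "V\<delta>_lin a x y z (- v) = - V\<delta>_lin a x y z v" "V\<delta>_lin a x y z 0 = (0::V\<delta>)"
    "V\<delta>_lin a x y z (c *\<^sub>C v) = c *\<^sub>C V\<delta>_lin a x y z v"
    "V\<delta>_lin a x y z (v + w) = V\<delta>_lin a x y z v + V\<delta>_lin a x y z w" for a x y z v w c
    using complex_vector.linear_neg[OF clinear_V\<delta>_lin] complex_vector.linear_0[OF clinear_V\<delta>_lin]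
      clinear_V\<delta>_lin[of a x y z] by (auto simp: clinear_iff)
  have two: "2 *\<^sub>C v = v + v" for v :: V\<delta>
    using scaleC_add_left[of 1 1 v] by (simp add: scaleC_one)
  have comp: "clinear (\<lambda>v. V\<delta>_act_gen (V\<delta>_act_gen v g) h)" for g h
    using lin by (simp add: clinear_iff)
  note diff = complex_vector.linear_compose_sub[OF comp comp]
  fix v
  show "V\<delta>_act_gen (V\<delta>_act_gen v Gen_Y) Gen_X - V\<delta>_act_gen (V\<delta>_act_gen v Gen_X) Gen_Y
      = V\<delta>_act_gen v Gen_X"
    by (rule V\<delta>_eqI[OF diff clinear_V\<delta>_act_gen]) (simp_all add: two)
  show "V\<delta>_act_gen (V\<delta>_act_gen v Gen_Y) Gen_\<delta>\<^sub>1 - V\<delta>_act_gen (V\<delta>_act_gen v Gen_\<delta>\<^sub>1) Gen_Y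
      = V\<delta>_act_gen v Gen_\<delta>\<^sub>1"
    by (rule V\<delta>_eqI[OF diff clinear_V\<delta>_act_gen]) simp_all
  show "V\<delta>_act_gen (V\<delta>_act_gen v Gen_X) Gen_\<delta>\<^sub>1 - V\<delta>_act_gen (V\<delta>_act_gen v Gen_\<delta>\<^sub>1) Gen_X
      = (1/2) *\<^sub>C V\<delta>_act_gen (V\<delta>_act_gen v Gen_\<delta>\<^sub>1) Gen_\<delta>\<^sub>1"
    by (rule V\<delta>_eqI[OF diff complex_vector.linear_compose_scale_right[OF comp]]) simp_all
qed (rule clinear_V\<delta>_act_gen)

definition V\<delta>_coact :: "V\<delta> \<Rightarrow> schwarzian \<otimes> V\<delta>"  ("\<nabla>")
  where "\<nabla> = V\<delta>_lin
    (1 \<otimes> \<^bold>1 + X \<otimes> \<^bold>R\<^sup>X + Y \<otimes> \<^bold>R\<^sup>Y)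
    (1 \<otimes> \<^bold>R\<^sup>X)
    (1 \<otimes> \<^bold>R\<^sup>Y + \<delta>\<^sub>1 \<otimes> \<^bold>R\<^sup>X)
    (1 \<otimes> \<^bold>R\<^sup>Z + \<delta>\<^sub>1 \<otimes> \<^bold>R\<^sup>Y + ((1/2) *\<^sub>C (\<delta>\<^sub>1 ^ 2)) \<otimes> \<^bold>R\<^sup>X)"

end

theory Submission
  imports Defs
begin

text \<open>
  The requirements on \<open>h\<close> in a Hopf algebra and in an anti-Yetter-Drinfeld module are compatible
  with products: if they hold for \<open>g\<close> and \<open>h\<close>, they hold for \<open>g * h\<close>.  Being linear as well, they
  hold everywhere as soon as they hold for \<open>X\<close>, \<open>Y\<close>, \<open>\<delta>\<^sub>1\<close>, because these generate the Schwarzian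
  algebra (\<open>schwarzian_induct\<close>).  What has to be found is the reason for this compatibility.

  \<^item> Both sides of coassociativity and of the counit laws are algebra homomorphisms in \<open>h\<close>, so that
    agreement on generators suffices (\<open>alg_hom_schwarzian_eqI\<close>).
  \<^item> The antipode laws do not compare homomorphisms.  Because \<open>S\<close> reverses products, however,
    \<open>S((gh)\<^bsub>(1)\<^esub>) (gh)\<^bsub>(2)\<^esub> = S(h\<^bsub>(1)\<^esub>) (S(g\<^bsub>(1)\<^esub>) g\<^bsub>(2)\<^esub>) h\<^bsub>(2)\<^esub>\<close>, where the inner bracket is the scalar
    \<open>\<epsilon>(g)\<close> and moves out (\<open>convolution_mult_left\<close>, \<open>convolution_mult_right\<close>).
  \<^item> The right-hand side of the anti-Yetter-Drinfeld condition comes from a right action of the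
    algebra \<open>H \<otimes> (H \<otimes> H)\<close> on \<open>H \<otimes> V\<close>, in which \<open>x \<otimes> (y \<otimes> z)\<close> sends \<open>a \<otimes> w\<close> to
    \<open>S(z) a x \<otimes> w y\<close>.  The iterated coproduct is an algebra homomorphism into \<open>H \<otimes> (H \<otimes> H)\<close>, so it
    makes \<open>H \<otimes> V\<close> a right \<open>H\<close>-module, and the condition says that \<open>\<nabla>\<close> is a module homomorphism
    (\<open>conj_act_mult\<close>, \<open>V\<delta>_anti_yetter_drinfeld\<close>).  This, too, has to be verified for generators only.

  All identities are linear in the module element, which leaves a finite calculation with the four
  basis vectors.  That these form a basis is seen from the coordinate functionals, which are the
  maps \<open>V\<delta>_lin\<close> with values in \<open>\<complex>\<close>.
\<close>

section \<open>Linear and multiplicative maps on tensor products\<close>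

lemma tensor_lift_add:
  "cbilinear \<beta> \<Longrightarrow> tensor_lift \<beta> (s + t) = tensor_lift \<beta> s + tensor_lift \<beta> t"
  using clinear_tensor_lift[of \<beta>] by (simp add: clinear_iff)

lemma tensor_lift_scaleC:
  "cbilinear \<beta> \<Longrightarrow> tensor_lift \<beta> (c *\<^sub>C t) = c *\<^sub>C tensor_lift \<beta> t"
  using clinear_tensor_lift[of \<beta>] by (simp add: clinear_iff)

lemma clinearD:
  assumes "clinear f"
  shows "f (x + y) = f x + f y" "f (c *\<^sub>C x) = c *\<^sub>C f x"
  using assms by (simp_all add: clinear_iff)

lemma clinear_comp: "clinear f \<Longrightarrow> clinear g \<Longrightarrow> clinear (\<lambda>x. g (f x))"
  by (simp add: clinear_iff)

lemma tensor_zero_right: "a \<otimes> 0 = 0"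
  using tensor_add_right[of a 0 0] by simp

lemma scaleC_two: "2 *\<^sub>C x = x + (x::'a::complex_vector)"
  using scaleC_add_left[of 1 1 x] by (simp add: scaleC_one)

lemmas bilinear_simps = algebra_simps scaleC_add_right tensor_add_left tensor_add_right
  tensor_scaleC_left tensor_scaleC_right mult_scaleC_left mult_scaleC_right

lemma cbilinear_tensor_map:
  assumes "clinear f" "clinear g"
  shows "cbilinear (\<lambda>a b. f a \<otimes> g b)"
  by (rule cbilinearI) (simp_all add: bilinear_simps clinearD[OF assms(1)] clinearD[OF assms(2)])

lemma tensor_map_tensor_of:
  assumes "clinear f" "clinear g"
  shows "tensor_map f g (a \<otimes> b) = f a \<otimes> g b"
  by (simp add: tensor_map_def tensor_lift_tensor_of cbilinear_tensor_map assms)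

lemma clinear_tensor_map:
  assumes "clinear f" "clinear g"
  shows "clinear (tensor_map f g)"
  unfolding tensor_map_def by (intro clinear_tensor_lift cbilinear_tensor_map assms)

lemma cbilinear_assoc_inner:
  "cbilinear (\<lambda>a b. (a::'a::complex_vector) \<otimes> ((b::'b::complex_vector) \<otimes> (c::'c::complex_vector)))"
  by (rule cbilinearI) (simp_all add: bilinear_simps)

lemma cbilinear_assoc_outer:
  "cbilinear (\<lambda>t (c::'c::complex_vector). tensor_lift
     (\<lambda>(a::'a::complex_vector) (b::'b::complex_vector). a \<otimes> (b \<otimes> c)) t)"
  by (rule cbilinearI)
     (simp_all add: bilinear_simps tensor_lift_fun_add tensor_lift_fun_scaleC
       tensor_lift_add[OF cbilinear_assoc_inner] tensor_lift_scaleC[OF cbilinear_assoc_inner])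

lemma tensor_assoc_tensor_of: "tensor_assoc ((a \<otimes> b) \<otimes> c) = a \<otimes> (b \<otimes> c)"
  by (simp add: tensor_assoc_def tensor_lift_tensor_of cbilinear_assoc_inner cbilinear_assoc_outer)

lemma clinear_tensor_assoc: "clinear tensor_assoc"
  unfolding tensor_assoc_def by (intro clinear_tensor_lift cbilinear_assoc_outer)

text \<open>
  Since pure tensors span, multiplicativity of a linear map on a tensor product is a condition on
  products of pure tensors.
\<close>

lemma alg_hom_on_tensorI:
  fixes f :: "'a::complex_algebra_1 \<otimes> 'b::complex_algebra_1 \<Rightarrow> 'c::complex_algebra_1"
  assumes lin: "clinear f" and one: "f (1 \<otimes> 1) = 1"
    and mult: "\<And>a b c d. f ((a * c) \<otimes> (b * d)) = f (a \<otimes> b) * f (c \<otimes> d)"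
  shows "alg_hom f"
proof -
  have "f (s * t) = f s * f t" for s t
  proof (induction s rule: tensor_induct)
    case (tensor a b)
    show ?case
      by (induction t rule: tensor_induct)
         (simp_all add: tensor_mult mult algebra_simps clinearD[OF lin])
  qed (simp add: algebra_simps clinearD[OF lin])
  with lin one show ?thesis by (simp add: alg_hom_def one_tensor_def)
qed

lemma alg_hom_tensor_map:
  assumes "alg_hom f" "alg_hom g"
  shows "alg_hom (tensor_map f g)"
proof -
  have lin: "clinear f" "clinear g" using assms by (simp_all add: alg_hom_def)
  show ?thesis
    by (rule alg_hom_on_tensorI)
       (use assms in \<open>simp_all add: clinear_tensor_map lin tensor_map_tensor_of tensor_mult
         alg_hom_def one_tensor_def\<close>)
qed

lemma alg_hom_tensor_assoc:
  "alg_hom (tensor_assoc :: ('a::complex_algebra_1 \<otimes> 'b::complex_algebra_1) \<otimes> 'c::complex_algebra_1 \<Rightarrow> _)"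
proof (rule alg_hom_on_tensorI)
  note lin = clinearD[OF clinear_tensor_assoc]
  fix s t :: "'a \<otimes> 'b" and c d :: 'c
  show "tensor_assoc ((s * t) \<otimes> (c * d)) = tensor_assoc (s \<otimes> c) * tensor_assoc (t \<otimes> d)"
  proof (induction s rule: tensor_induct)
    case (tensor a b)
    show ?case
      by (induction t rule: tensor_induct)
         (simp_all add: tensor_mult tensor_assoc_tensor_of algebra_simps tensor_add_left lin)
  qed (simp add: algebra_simps tensor_add_left lin)
qed (simp_all add: clinear_tensor_assoc tensor_assoc_tensor_of one_tensor_def)

lemma clinear_id_fun: "clinear (id :: 'a::complex_vector \<Rightarrow> 'a)"
  by (simp add: clinear_iff)

lemma alg_hom_id: "alg_hom (id :: 'a::complex_algebra_1 \<Rightarrow> 'a)"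
  by (simp add: alg_hom_def clinear_id_fun)

lemma alg_hom_comp: "alg_hom f \<Longrightarrow> alg_hom g \<Longrightarrow> alg_hom (\<lambda>x. g (f x))"
  by (simp add: alg_hom_def clinear_iff)


section \<open>Generation of the Schwarzian algebra by its three generators\<close>

text \<open>
  A subalgebra that contains the generators is everything: an element is represented by a linear
  combination of words, and a word is a product of letters.
\<close>

lemma schwarzian_induct [case_names one X Y \<delta>\<^sub>1 add scaleC mult]:
  assumes "P 1" "P X" "P Y" "P \<delta>\<^sub>1"
    and add: "\<And>g h. P g \<Longrightarrow> P h \<Longrightarrow> P (g + h)"
    and scaleC: "\<And>c h. P h \<Longrightarrow> P (c *\<^sub>C h)"
    and mult: "\<And>g h. P g \<Longrightarrow> P h \<Longrightarrow> P (g * h)"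
  shows "P h"
proof (induction h rule: schwarzian.abs_induct)
  case (1 p)
  have word: "P (abs_schwarzian (Poly_Mapping.single (Word gs) 1))" for gs
  proof (induction gs)
    case Nil
    have "abs_schwarzian (Poly_Mapping.single (Word []) 1) = 1"
      by (simp add: one_schwarzian.abs_eq single_one zero_free_monoid_def[symmetric])
    with assms(1) show ?case by simp
  next
    case (Cons g gs)
    have "Poly_Mapping.single (Word (g # gs)) 1 = free_gen g * Poly_Mapping.single (Word gs) 1"
      by (simp add: free_gen_def mult_single plus_free_monoid_def)
    then have "abs_schwarzian (Poly_Mapping.single (Word (g # gs)) 1)
        = abs_schwarzian (free_gen g) * abs_schwarzian (Poly_Mapping.single (Word gs) 1)"
      by (simp add: times_schwarzian.abs_eq)
    moreover have "P (abs_schwarzian (free_gen g))"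
      using assms(2-4) by (cases g) (simp_all add: X.abs_eq Y.abs_eq \<delta>\<^sub>1.abs_eq)
    ultimately show ?case using Cons mult by simp
  qed
  show ?case
  proof (induction p rule: free_induct)
    case (single w c)
    have "P (c *\<^sub>C abs_schwarzian (Poly_Mapping.single w 1))"
      using scaleC word[of "letters w"] by simp
    then show ?case by (simp add: scaleC_schwarzian.abs_eq scaleC_single)
  next
    case (add p q)
    then show ?case using assms(5) by (simp add: plus_schwarzian.abs_eq[symmetric])
  qed
qed

text \<open>
  The elements on which two algebra homomorphisms agree form a subalgebra.
\<close>

lemma alg_hom_schwarzian_eqI:
  assumes f: "alg_hom f" and g: "alg_hom g"
    and "f X = g X" "f Y = g Y" "f \<delta>\<^sub>1 = g \<delta>\<^sub>1"
  shows "f h = g h"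
  by (induction h rule: schwarzian_induct)
     (use assms in \<open>simp_all add: alg_hom_def clinear_iff\<close>)

text \<open>
  The unit of the free algebra is the empty word; written as a monomial it can be fed to
  \<open>lin_ext_single\<close>.
\<close>

lemma one_free_algebra: "(1 :: 'g free_algebra) = Poly_Mapping.single 0 1"
  by simp

lemma alg_hom_if_free_hom:
  assumes F: "\<And>p. F (abs_schwarzian p) = free_hom f p"
  shows "alg_hom F"
proof -
  have "F (g + h) = F g + F h" for g h
    by (induction g rule: schwarzian.abs_induct; induction h rule: schwarzian.abs_induct)
       (simp add: plus_schwarzian.abs_eq F free_hom_def lin_ext_add)
  moreover have "F (g * h) = F g * F h" for g h
    by (induction g rule: schwarzian.abs_induct; induction h rule: schwarzian.abs_induct)
       (simp add: times_schwarzian.abs_eq F free_hom_mult)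
  moreover have "F (c *\<^sub>C h) = c *\<^sub>C F h" for c h
    by (induction h rule: schwarzian.abs_induct)
       (simp add: scaleC_schwarzian.abs_eq F free_hom_def lin_ext_scaleC)
  moreover have "F 1 = 1"
    unfolding one_schwarzian.abs_eq F one_free_algebra free_hom_def lin_ext_single
    by (simp add: scaleC_one)
  ultimately show ?thesis by (simp add: alg_hom_def clinear_iff)
qed

section \<open>The Hopf algebra axioms\<close>

lemma alg_hom_comult: "alg_hom comult"
  using comult.abs_eq by (rule alg_hom_if_free_hom)

lemma alg_hom_counit: "alg_hom counit"
  using counit.abs_eq by (rule alg_hom_if_free_hom)

lemma clinear_antipode: "clinear antipode"
proof -
  have "antipode (g + h) = antipode g + antipode h" for g h
    by (induction g rule: schwarzian.abs_induct; induction h rule: schwarzian.abs_induct)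
       (simp add: plus_schwarzian.abs_eq antipode.abs_eq free_antihom_def lin_ext_add)
  moreover have "antipode (c *\<^sub>C h) = c *\<^sub>C antipode h" for c h
    by (induction h rule: schwarzian.abs_induct)
       (simp add: scaleC_schwarzian.abs_eq antipode.abs_eq free_antihom_def lin_ext_scaleC)
  ultimately show ?thesis by (simp add: clinear_iff)
qed

lemma antipode_one: "antipode 1 = 1"
  unfolding one_schwarzian.abs_eq antipode.abs_eq one_free_algebra free_antihom_def lin_ext_single
  by (simp add: scaleC_one one_schwarzian.abs_eq)

lemma antipode_mult: "antipode (g * h) = antipode h * antipode g"
  by (induction g rule: schwarzian.abs_induct; induction h rule: schwarzian.abs_induct)
     (simp add: times_schwarzian.abs_eq antipode.abs_eq free_antihom_mult)

lemma comult_mult: "comult (g * h) = comult g * comult h"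
  using alg_hom_comult by (simp add: alg_hom_def)

lemmas comult_hom_simps = alg_hom_comult[unfolded alg_hom_def clinear_iff]
lemmas counit_hom_simps = alg_hom_counit[unfolded alg_hom_def clinear_iff]

lemma comult_coassociative:
  "tensor_assoc (tensor_map comult id (comult h)) = tensor_map id comult (comult h)"
proof -
  have lin: "clinear comult" using alg_hom_comult by (simp add: alg_hom_def)
  note maps = clinearD[OF clinear_tensor_map[OF lin clinear_id_fun]]
    clinearD[OF clinear_tensor_map[OF clinear_id_fun lin]] clinearD[OF clinear_tensor_assoc]
    tensor_map_tensor_of[OF lin clinear_id_fun] tensor_map_tensor_of[OF clinear_id_fun lin]
    tensor_assoc_tensor_of
  show ?thesis
  proof (rule alg_hom_schwarzian_eqI)
    show "alg_hom (\<lambda>h. tensor_assoc (tensor_map comult id (comult h)))"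
      by (intro alg_hom_comp[OF _ alg_hom_tensor_assoc] alg_hom_comp[OF alg_hom_comult]
          alg_hom_tensor_map alg_hom_comult alg_hom_id)
    show "alg_hom (\<lambda>h. tensor_map id comult (comult h))"
      by (intro alg_hom_comp[OF alg_hom_comult] alg_hom_tensor_map alg_hom_comult alg_hom_id)
  qed (simp_all add: comult_simps comult_hom_simps one_tensor_def tensor_add_left tensor_add_right
      id_def maps[unfolded id_def])
qed

lemma cbilinear_character_scaleC:
  assumes "alg_hom (\<epsilon> :: 'h::complex_algebra_1 \<Rightarrow> complex)"
  shows "cbilinear (\<lambda>a (b::'b::complex_vector). \<epsilon> a *\<^sub>C b)"
    "cbilinear (\<lambda>(b::'b) a. \<epsilon> a *\<^sub>C b)"
  using assms by (auto intro!: cbilinearI simp: alg_hom_def clinear_iff scaleC_add_left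
      scaleC_add_right scaleC_scaleC mult.commute)

text \<open>
  Applying a character to one tensor factor is multiplicative because scalars are central.  The
  two sides of a counit law thereby become algebra homomorphisms.
\<close>

lemma alg_hom_slice:
  assumes "alg_hom (\<epsilon> :: 'h::complex_algebra_1 \<Rightarrow> complex)"
  shows "alg_hom (tensor_lift (\<lambda>a (b::'b::complex_algebra_1). \<epsilon> a *\<^sub>C b))"
    "alg_hom (tensor_lift (\<lambda>(b::'b) a. \<epsilon> a *\<^sub>C b))"
proof -
  note bil = cbilinear_character_scaleC[OF assms, where 'b = 'b]
  have \<epsilon>: "\<epsilon> 1 = 1" "\<epsilon> (g * h) = \<epsilon> g * \<epsilon> h" for g h
    using assms by (simp_all add: alg_hom_def)
  show "alg_hom (tensor_lift (\<lambda>a (b::'b). \<epsilon> a *\<^sub>C b))"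
    "alg_hom (tensor_lift (\<lambda>(b::'b) a. \<epsilon> a *\<^sub>C b))"
    by (rule alg_hom_on_tensorI; simp add: clinear_tensor_lift bil tensor_lift_tensor_of \<epsilon>
      scaleC_one mult_scaleC_left mult_scaleC_right scaleC_scaleC mult.commute)+
qed

lemma comult_counit:
  "tensor_lift (\<lambda>a b. counit a *\<^sub>C b) (comult h) = h"
  "tensor_lift (\<lambda>a b. counit b *\<^sub>C a) (comult h) = h"
proof -
  note bil = cbilinear_character_scaleC[OF alg_hom_counit, where 'b = schwarzian]
  note slice = alg_hom_comp[OF alg_hom_comult alg_hom_slice(1)[OF alg_hom_counit]]
    alg_hom_comp[OF alg_hom_comult alg_hom_slice(2)[OF alg_hom_counit]]
  show "tensor_lift (\<lambda>a b. counit a *\<^sub>C b) (comult h) = h"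
    by (rule alg_hom_schwarzian_eqI[OF slice(1) alg_hom_id[unfolded id_def]])
       (simp_all add: comult_simps tensor_lift_add bil tensor_lift_tensor_of counit_simps
         counit_hom_simps scaleC_one)
  show "tensor_lift (\<lambda>a b. counit b *\<^sub>C a) (comult h) = h"
    by (rule alg_hom_schwarzian_eqI[OF slice(2) alg_hom_id[unfolded id_def]])
       (simp_all add: comult_simps tensor_lift_add bil tensor_lift_tensor_of counit_simps
         counit_hom_simps scaleC_one)
qed

text \<open>
  Let \<open>L\<close> be the map \<open>a \<otimes> b \<mapsto> S(a) b\<close>.  It is not multiplicative, but as \<open>S\<close> reverses products,
  \<open>L(t u)\<close> arises from \<open>u\<close> by inserting \<open>L(t)\<close> between the two factors; for
  \<open>a \<otimes> b \<mapsto> a S(b)\<close> it is the value on \<open>u\<close> that is inserted between the factors of \<open>t\<close>.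
\<close>

context
  fixes S :: "'h::complex_algebra_1 \<Rightarrow> 'h"
  assumes linear_S: "clinear S" and S_mult: "\<And>g h. S (g * h) = S h * S g"
begin

lemma cbilinear_convolution: "cbilinear (\<lambda>a b. S a * (u * b))" "cbilinear (\<lambda>a b. a * (u * S b))"
  by (auto intro!: cbilinearI simp: clinearD[OF linear_S] algebra_simps mult_scaleC_left mult_scaleC_right)

lemmas cbilinear_convolution_one =
  cbilinear_convolution(1)[of 1, unfolded mult_1_left] cbilinear_convolution(2)[of 1, unfolded mult_1_left]

lemma convolution_mult_left:
  "tensor_lift (\<lambda>a b. S a * b) (t * u)
    = tensor_lift (\<lambda>a b. S a * (tensor_lift (\<lambda>a b. S a * b) t * b)) u"
proof (induction u rule: tensor_induct)
  case (tensor c d)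
  show ?case
    by (induction t rule: tensor_induct)
       (simp_all add: tensor_mult tensor_lift_tensor_of tensor_lift_add cbilinear_convolution
         cbilinear_convolution_one S_mult algebra_simps tensor_lift_fun_add
         cbilinear_convolution[of "x * y" for x y, unfolded mult.assoc])
qed (simp add: distrib_left tensor_lift_add cbilinear_convolution cbilinear_convolution_one)

lemma convolution_mult_right:
  "tensor_lift (\<lambda>a b. a * S b) (t * u)
    = tensor_lift (\<lambda>a b. a * (tensor_lift (\<lambda>a b. a * S b) u * S b)) t"
proof (induction t rule: tensor_induct)
  case (tensor c d)
  show ?case
    by (induction u rule: tensor_induct)
       (simp_all add: tensor_mult tensor_lift_tensor_of tensor_lift_add cbilinear_convolution
         cbilinear_convolution_one S_mult algebra_simps tensor_lift_fun_add
         cbilinear_convolution[of "x * y" for x y, unfolded mult.assoc])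
qed (simp add: distrib_right tensor_lift_add cbilinear_convolution cbilinear_convolution_one)

end

text \<open>
  In the step to a product, the value inserted in the middle is the scalar given by the counit.
  On generators the laws reduce to cancellation; for \<open>X\<close> the summand \<open>Y * \<delta>\<^sub>1\<close> of the antipode
  cancels the contribution of \<open>Y \<otimes> \<delta>\<^sub>1\<close>.
\<close>

lemma comult_antipode:
  "tensor_lift (\<lambda>a b. antipode a * b) (comult h) = counit h *\<^sub>C 1" (is "?L (comult h) = _")
  "tensor_lift (\<lambda>a b. a * antipode b) (comult h) = counit h *\<^sub>C 1" (is "?R (comult h) = _")
proof -
  note bil = cbilinear_convolution_one[OF clinear_antipode antipode_mult]
  show "?L (comult h) = counit h *\<^sub>C 1"
  proof (induction h rule: schwarzian_induct)
    case (mult g h)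
    have "?L (comult (g * h)) = tensor_lift (\<lambda>a b. counit g *\<^sub>C (antipode a * b)) (comult h)"
      unfolding comult_mult convolution_mult_left[OF clinear_antipode antipode_mult] mult(1)
      by (simp add: mult_scaleC_left mult_scaleC_right)
    with mult(2) show ?case
      by (simp add: tensor_lift_fun_scaleC counit_hom_simps scaleC_scaleC)
  qed (simp_all add: comult_simps comult_hom_simps counit_simps counit_hom_simps one_tensor_def
      tensor_lift_tensor_of tensor_lift_add tensor_lift_scaleC bil antipode_simps antipode_one
      scaleC_add_left scaleC_scaleC)
  show "?R (comult h) = counit h *\<^sub>C 1"
  proof (induction h rule: schwarzian_induct)
    case (mult g h)
    have "?R (comult (g * h)) = tensor_lift (\<lambda>a b. counit h *\<^sub>C (a * antipode b)) (comult g)"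
      unfolding comult_mult convolution_mult_right[OF clinear_antipode antipode_mult] mult(2)
      by (simp add: mult_scaleC_left mult_scaleC_right)
    with mult(1) show ?case
      by (simp add: tensor_lift_fun_scaleC counit_hom_simps scaleC_scaleC mult.commute)
  qed (simp_all add: comult_simps comult_hom_simps counit_simps counit_hom_simps one_tensor_def
      tensor_lift_tensor_of tensor_lift_add tensor_lift_scaleC bil antipode_simps antipode_one
      scaleC_add_left scaleC_scaleC)
qed

interpretation schwarzian: hopf_algebra comult counit antipode
  by (intro hopf_algebra.intro alg_hom_comult alg_hom_counit clinear_antipode
      comult_coassociative comult_counit comult_antipode)

section \<open>The module and the comodule\<close>

interpretation V\<delta>: right_module "(\<triangleleft>)"
proof
  have act_add: "v \<triangleleft> (g + h) = v \<triangleleft> g + v \<triangleleft> h" for v g h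
    by (induction g rule: schwarzian.abs_induct; induction h rule: schwarzian.abs_induct)
       (simp add: plus_schwarzian.abs_eq V\<delta>_act.abs_eq free_act_def lin_ext_add)
  have act_scaleC: "v \<triangleleft> (c *\<^sub>C h) = c *\<^sub>C (v \<triangleleft> h)" for v c h
    by (induction h rule: schwarzian.abs_induct)
       (simp add: scaleC_schwarzian.abs_eq V\<delta>_act.abs_eq free_act_def lin_ext_scaleC)
  have "(v + w) \<triangleleft> h = v \<triangleleft> h + w \<triangleleft> h" "(c *\<^sub>C v) \<triangleleft> h = c *\<^sub>C (v \<triangleleft> h)" for v w c h
    by (induction h rule: schwarzian.abs_induct;
        simp add: V\<delta>_act.abs_eq clinearD[OF free_act_linear[OF clinear_V\<delta>_act_gen]])+
  with act_add act_scaleC show "cbilinear (\<triangleleft>)" by (intro cbilinearI)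
  fix v g h
  show "v \<triangleleft> 1 = v"
    unfolding one_schwarzian.abs_eq V\<delta>_act.abs_eq one_free_algebra free_act_def lin_ext_single
    by (simp add: scaleC_one)
  show "v \<triangleleft> (g * h) = (v \<triangleleft> g) \<triangleleft> h"
    by (induction g rule: schwarzian.abs_induct; induction h rule: schwarzian.abs_induct)
       (simp add: times_schwarzian.abs_eq V\<delta>_act.abs_eq free_act_mult[OF clinear_V\<delta>_act_gen])
qed

lemma V\<delta>_act_table:
  "\<^bold>1 \<triangleleft> X = 0" "\<^bold>1 \<triangleleft> Y = \<^bold>1" "\<^bold>1 \<triangleleft> \<delta>\<^sub>1 = \<^bold>R\<^sup>Z"
  "\<^bold>R\<^sup>X \<triangleleft> X = - \<^bold>R\<^sup>Y" "\<^bold>R\<^sup>X \<triangleleft> Y = 2 *\<^sub>C \<^bold>R\<^sup>X" "\<^bold>R\<^sup>X \<triangleleft> \<delta>\<^sub>1 = 0"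
  "\<^bold>R\<^sup>Y \<triangleleft> X = - \<^bold>R\<^sup>Z" "\<^bold>R\<^sup>Y \<triangleleft> Y = \<^bold>R\<^sup>Y" "\<^bold>R\<^sup>Y \<triangleleft> \<delta>\<^sub>1 = 0"
  "\<^bold>R\<^sup>Z \<triangleleft> X = 0" "\<^bold>R\<^sup>Z \<triangleleft> Y = 0" "\<^bold>R\<^sup>Z \<triangleleft> \<delta>\<^sub>1 = 0"
  by (simp_all add: X.abs_eq Y.abs_eq \<delta>\<^sub>1.abs_eq V\<delta>_act.abs_eq)

lemma V\<delta>_coact_table:
  "\<nabla> \<^bold>1 = 1 \<otimes> \<^bold>1 + X \<otimes> \<^bold>R\<^sup>X + Y \<otimes> \<^bold>R\<^sup>Y"
  "\<nabla> \<^bold>R\<^sup>X = 1 \<otimes> \<^bold>R\<^sup>X"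
  "\<nabla> \<^bold>R\<^sup>Y = 1 \<otimes> \<^bold>R\<^sup>Y + \<delta>\<^sub>1 \<otimes> \<^bold>R\<^sup>X"
  "\<nabla> \<^bold>R\<^sup>Z = 1 \<otimes> \<^bold>R\<^sup>Z + \<delta>\<^sub>1 \<otimes> \<^bold>R\<^sup>Y + ((1/2) *\<^sub>C (\<delta>\<^sub>1 ^ 2)) \<otimes> \<^bold>R\<^sup>X"
  by (simp_all add: V\<delta>_coact_def)

lemma clinear_V\<delta>_coact: "clinear \<nabla>"
  unfolding V\<delta>_coact_def by (rule clinear_V\<delta>_lin)

text \<open>
  Coassociativity matches the coactions of different basis vectors: for instance the term
  \<open>Y \<otimes> \<delta>\<^sub>1\<close> in the coproduct of \<open>X\<close> corresponds to \<open>\<delta>\<^sub>1 \<otimes> \<^bold>R\<^sup>X\<close> in \<open>\<nabla> \<^bold>R\<^sup>Y\<close>, and the mixed term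
  \<open>\<delta>\<^sub>1 \<otimes> \<delta>\<^sub>1\<close> in the coproduct of \<open>\<delta>\<^sub>1\<^sup>2\<close> explains the factor \<open>1/2\<close> in \<open>\<nabla> \<^bold>R\<^sup>Z\<close>.
\<close>

interpretation V\<delta>: left_comodule comult counit "\<nabla>"
proof (rule left_comodule.intro)
  show "clinear \<nabla>" by (rule clinear_V\<delta>_coact)
  have lin: "clinear comult" using alg_hom_comult by (simp add: alg_hom_def)
  note maps = clinearD[OF clinear_tensor_map[OF lin clinear_id_fun]]
    clinearD[OF clinear_tensor_map[OF clinear_id_fun clinear_V\<delta>_coact]] clinearD[OF clinear_tensor_assoc]
    tensor_map_tensor_of[OF lin clinear_id_fun] tensor_map_tensor_of[OF clinear_id_fun clinear_V\<delta>_coact]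
    tensor_assoc_tensor_of
  note bil = cbilinear_character_scaleC(1)[OF alg_hom_counit]
  fix v :: V\<delta>
  show "tensor_assoc (tensor_map comult id (\<nabla> v)) = tensor_map id \<nabla> (\<nabla> v)"
  proof (rule V\<delta>_eqI)
    show "clinear (\<lambda>v. tensor_assoc (tensor_map comult id (\<nabla> v)))"
      "clinear (\<lambda>v. tensor_map id \<nabla> (\<nabla> v))"
      by (intro clinear_comp[OF _ clinear_tensor_assoc] clinear_comp[OF clinear_V\<delta>_coact]
          clinear_tensor_map lin clinear_id_fun clinear_V\<delta>_coact)+
  qed (simp_all add: V\<delta>_coact_table id_def maps[unfolded id_def] comult_simps comult_hom_simps one_tensor_def tensor_mult
      power2_eq_square tensor_add_left tensor_add_right tensor_scaleC_left tensor_scaleC_right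
      scaleC_add_right scaleC_half_add algebra_simps)
  show "tensor_lift (\<lambda>a w. counit a *\<^sub>C w) (\<nabla> v) = v"
  proof (rule V\<delta>_eqI)
    show "clinear (\<lambda>v. tensor_lift (\<lambda>a w. counit a *\<^sub>C w) (\<nabla> v))"
      by (intro clinear_comp[OF clinear_V\<delta>_coact] clinear_tensor_lift bil)
    show "clinear (\<lambda>v :: V\<delta>. v)" by (simp add: clinear_iff)
  qed (simp_all add: V\<delta>_coact_table tensor_lift_add tensor_lift_tensor_of bil counit_simps
      counit_hom_simps scaleC_one power2_eq_square)
qed


section \<open>The anti-Yetter-Drinfeld condition\<close>

text \<open>
  An algebra \<open>H\<close> with an anti-endomorphism \<open>S\<close> and a right module \<open>V\<close> give a right action of
  \<open>H \<otimes> (H \<otimes> H)\<close> on \<open>H \<otimes> V\<close>: the first and third factor act on \<open>H\<close> by two-sided multiplication,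
  the third one twisted by \<open>S\<close>, and the middle one acts on \<open>V\<close>.
\<close>

locale twisted_conjugation = right_module act
  for act :: "'v::complex_vector \<Rightarrow> 'h::complex_algebra_1 \<Rightarrow> 'v"  (infixl "\<lhd>" 70) +
  fixes S :: "'h \<Rightarrow> 'h"
  assumes linear_S: "clinear S" and S_one: "S 1 = 1" and S_mult: "S (g * h) = S h * S g"
begin

definition conj_act :: "'h \<otimes> ('h \<otimes> 'h) \<Rightarrow> 'h \<otimes> 'v \<Rightarrow> 'h \<otimes> 'v"
  where "conj_act \<tau> s = tensor_lift (\<lambda>h1. tensor_lift (\<lambda>h2 h3.
    tensor_lift (\<lambda>a w. (S h3 * a * h1) \<otimes> (w \<lhd> h2)) s)) \<tau>"

lemma act_linear:
  "(v + w) \<lhd> h = v \<lhd> h + w \<lhd> h" "(c *\<^sub>C v) \<lhd> h = c *\<^sub>C (v \<lhd> h)"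
  "v \<lhd> (g + h) = v \<lhd> g + v \<lhd> h" "v \<lhd> (c *\<^sub>C h) = c *\<^sub>C (v \<lhd> h)"
  using cbilinear_act by (simp_all add: cbilinear_def clinear_iff)

lemmas conj_linear = clinearD[OF linear_S] act_linear bilinear_simps
  tensor_lift_fun_add tensor_lift_fun_scaleC

text \<open>
  A map defined by \<open>tensor_lift\<close> can be evaluated on pure tensors only if its argument is known to
  be bilinear; the definition of \<open>conj_act\<close> nests three such maps.
\<close>

lemma cbilinear_conj1: "cbilinear (\<lambda>a w. (S h3 * (a * h1)) \<otimes> (w \<lhd> h2))"
  by (rule cbilinearI) (simp_all add: conj_linear)

lemma cbilinear_conj2:
  "cbilinear (\<lambda>h2 h3. tensor_lift (\<lambda>a w. (S h3 * (a * h1)) \<otimes> (w \<lhd> h2)) s)"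
  by (rule cbilinearI) (simp_all add: conj_linear)

lemma cbilinear_conj3:
  "cbilinear (\<lambda>h1. tensor_lift (\<lambda>h2 h3. tensor_lift (\<lambda>a w. (S h3 * (a * h1)) \<otimes> (w \<lhd> h2)) s))"
  by (rule cbilinearI)
     (simp_all add: conj_linear tensor_lift_add[OF cbilinear_conj2] tensor_lift_scaleC[OF cbilinear_conj2])

lemma conj_act_tensor_of:
  "conj_act (x \<otimes> (y \<otimes> z)) (a \<otimes> w) = (S z * (a * x)) \<otimes> (w \<lhd> y)"
  unfolding conj_act_def mult.assoc
  by (subst tensor_lift_tensor_of[OF cbilinear_conj3], subst tensor_lift_tensor_of[OF cbilinear_conj2],
      rule tensor_lift_tensor_of[OF cbilinear_conj1])

lemma cbilinear_conj_act: "cbilinear conj_act"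
  unfolding conj_act_def mult.assoc
proof (rule cbilinearI)
  fix \<tau> :: "'h \<otimes> ('h \<otimes> 'h)" and s t :: "'h \<otimes> 'v" and c :: complex
  let ?f = "\<lambda>s h1 k. tensor_lift (\<lambda>h2 h3. tensor_lift (\<lambda>a w. (S h3 * (a * h1)) \<otimes> (w \<lhd> h2)) s) k"
  show "tensor_lift (?f (s + t)) \<tau> = tensor_lift (?f s) \<tau> + tensor_lift (?f t) \<tau>"
    by (simp add: tensor_lift_add[OF cbilinear_conj1] tensor_lift_fun_add)
  show "tensor_lift (?f (c *\<^sub>C s)) \<tau> = c *\<^sub>C tensor_lift (?f s) \<tau>"
    by (simp add: tensor_lift_scaleC[OF cbilinear_conj1] tensor_lift_fun_scaleC)
qed (simp_all add: tensor_lift_add[OF cbilinear_conj3] tensor_lift_scaleC[OF cbilinear_conj3])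

lemma conj_act_linear:
  "conj_act (\<tau> + \<tau>') s = conj_act \<tau> s + conj_act \<tau>' s" "conj_act (c *\<^sub>C \<tau>) s = c *\<^sub>C conj_act \<tau> s"
  "conj_act \<tau> (s + t) = conj_act \<tau> s + conj_act \<tau> t" "conj_act \<tau> (c *\<^sub>C s) = c *\<^sub>C conj_act \<tau> s"
  using cbilinear_conj_act by (simp_all add: cbilinear_def clinear_iff)

lemma conj_act_one: "conj_act 1 s = s"
  by (induction s rule: tensor_induct)
     (simp_all add: conj_act_linear one_tensor_def conj_act_tensor_of S_one act_one)

text \<open>
  The action law rests on \<open>S(z') S(z) a x x' = S(z z') a (x x')\<close>: the outer factors multiply on
  opposite sides, and \<open>S\<close> corrects the order of the left ones.
\<close>

lemma conj_act_mult: "conj_act (\<tau> * \<tau>') s = conj_act \<tau>' (conj_act \<tau> s)"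
proof (induction s rule: tensor_induct)
  case (tensor a w)
  have pure: "conj_act ((x \<otimes> t) * (x' \<otimes> t')) (a \<otimes> w)
      = conj_act (x' \<otimes> t') (conj_act (x \<otimes> t) (a \<otimes> w))" for x x' t t'
  proof (induction t rule: tensor_induct)
    case (tensor y z)
    show ?case
      by (induction t' rule: tensor_induct)
         (simp_all add: tensor_mult conj_act_tensor_of S_mult act_mult mult.assoc
           distrib_left tensor_add_right conj_act_linear)
  qed (simp add: tensor_mult distrib_right tensor_add_right conj_act_linear)
  show ?case
  proof (induction \<tau> rule: tensor_induct)
    case (tensor x t)
    show ?case
      by (induction \<tau>' rule: tensor_induct) (simp_all add: pure distrib_left conj_act_linear)
  qed (simp add: distrib_right conj_act_linear)
qed (simp add: conj_act_linear)

text \<open>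
  The Sweedler expression of \<open>right_left_SAYD\<close> is the action of the iterated coproduct.
\<close>

lemma conj_act_tensor_map:
  fixes \<Delta> :: "'h \<Rightarrow> 'h \<otimes> 'h"
  assumes "clinear \<Delta>"
  shows "conj_act (tensor_map id \<Delta> t) s = tensor_lift (\<lambda>h1 k. tensor_lift (\<lambda>h2 h3.
    tensor_lift (\<lambda>a w. (S h3 * a * h1) \<otimes> (w \<lhd> h2)) s) (\<Delta> k)) t"
proof (induction t rule: tensor_induct)
  have bil: "cbilinear (\<lambda>h1 k. tensor_lift (\<lambda>h2 h3.
    tensor_lift (\<lambda>a w. (S h3 * (a * h1)) \<otimes> (w \<lhd> h2)) s) (\<Delta> k))"
    by (rule cbilinearI)
       (simp_all add: conj_linear tensor_lift_add[OF cbilinear_conj2]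
         tensor_lift_scaleC[OF cbilinear_conj2] clinearD[OF assms])
  {
    case (tensor x k)
    show ?case
      unfolding tensor_map_tensor_of[OF clinear_id_fun assms] conj_act_def mult.assoc
      by (simp add: tensor_lift_tensor_of bil cbilinear_conj3)
  next
    case (add t u)
    then show ?case
      unfolding mult.assoc
      by (simp add: tensor_lift_add bil conj_act_linear
          id_def clinearD[OF clinear_tensor_map[OF clinear_id_fun assms], unfolded id_def])
  }
qed

end

interpretation V\<delta>: twisted_conjugation "(\<triangleleft>)" antipode
  by (intro twisted_conjugation.intro twisted_conjugation_axioms.intro V\<delta>.right_module_axioms
      clinear_antipode antipode_one antipode_mult)

definition comult3 :: "schwarzian \<Rightarrow> schwarzian \<otimes> (schwarzian \<otimes> schwarzian)"
  where "comult3 h = tensor_map id comult (comult h)"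

lemma alg_hom_comult3: "alg_hom comult3"
  unfolding comult3_def[abs_def]
  by (intro alg_hom_comp[OF alg_hom_comult] alg_hom_tensor_map alg_hom_comult alg_hom_id)

lemma comult3_simps:
  "comult3 X = X \<otimes> (1 \<otimes> 1) + 1 \<otimes> (X \<otimes> 1) + 1 \<otimes> (1 \<otimes> X) + 1 \<otimes> (Y \<otimes> \<delta>\<^sub>1)
    + Y \<otimes> (\<delta>\<^sub>1 \<otimes> 1) + Y \<otimes> (1 \<otimes> \<delta>\<^sub>1)"
  "comult3 Y = Y \<otimes> (1 \<otimes> 1) + 1 \<otimes> (Y \<otimes> 1) + 1 \<otimes> (1 \<otimes> Y)"
  "comult3 \<delta>\<^sub>1 = \<delta>\<^sub>1 \<otimes> (1 \<otimes> 1) + 1 \<otimes> (\<delta>\<^sub>1 \<otimes> 1) + 1 \<otimes> (1 \<otimes> \<delta>\<^sub>1)"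
proof -
  have lin: "clinear comult" using alg_hom_comult by (simp add: alg_hom_def)
  note maps = clinearD[OF clinear_tensor_map[OF clinear_id_fun lin]]
    tensor_map_tensor_of[OF clinear_id_fun lin]
  show "comult3 X = X \<otimes> (1 \<otimes> 1) + 1 \<otimes> (X \<otimes> 1) + 1 \<otimes> (1 \<otimes> X) + 1 \<otimes> (Y \<otimes> \<delta>\<^sub>1)
      + Y \<otimes> (\<delta>\<^sub>1 \<otimes> 1) + Y \<otimes> (1 \<otimes> \<delta>\<^sub>1)"
    "comult3 Y = Y \<otimes> (1 \<otimes> 1) + 1 \<otimes> (Y \<otimes> 1) + 1 \<otimes> (1 \<otimes> Y)"
    "comult3 \<delta>\<^sub>1 = \<delta>\<^sub>1 \<otimes> (1 \<otimes> 1) + 1 \<otimes> (\<delta>\<^sub>1 \<otimes> 1) + 1 \<otimes> (1 \<otimes> \<delta>\<^sub>1)"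
    by (simp_all add: comult3_def id_def maps[unfolded id_def] comult_simps comult_hom_simps one_tensor_def
        tensor_add_right)
qed

lemma clinear_act: "clinear (\<lambda>v :: V\<delta>. v \<triangleleft> h)"
  by (simp add: clinear_iff V\<delta>.act_linear)

text \<open>
  For the primitive elements \<open>h = Y\<close> and \<open>h = \<delta>\<^sub>1\<close> the condition becomes
  \<open>\<nabla>(v h) = [v\<^bsub>\<langle>-1\<rangle>\<^esub>, h] \<otimes> v\<^bsub>\<langle>0\<rangle>\<^esub> + v\<^bsub>\<langle>-1\<rangle>\<^esub> \<otimes> v\<^bsub>\<langle>0\<rangle>\<^esub> h\<close>.  For \<open>h = X\<close> there are the six terms of
  \<open>comult3_simps\<close>.  In all cases, moving \<open>\<delta>\<^sub>1\<close> to the left of \<open>X\<close> and \<open>X\<close> to the left of \<open>Y\<close> by the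
  defining relations brings both sides to the same form.
\<close>

lemma V\<delta>_anti_yetter_drinfeld:
  "\<nabla> (v \<triangleleft> h) = V\<delta>.conj_act (comult3 h) (\<nabla> v)"
proof (induction h arbitrary: v rule: schwarzian_induct)
  have lin: "clinear (\<lambda>v. \<nabla> (v \<triangleleft> h))" "clinear (\<lambda>v. V\<delta>.conj_act \<tau> (\<nabla> v))" for h \<tau>
    by (simp_all add: clinear_iff V\<delta>.act_linear clinearD[OF clinear_V\<delta>_coact] V\<delta>.conj_act_linear)
  note neg = complex_vector.linear_neg[OF clinear_V\<delta>_coact] complex_vector.linear_0[OF clinear_V\<delta>_coact]
  note hom = alg_hom_comult3[unfolded alg_hom_def clinear_iff]
  note eval = V\<delta>_act_table V\<delta>_coact_table comult3_simps V\<delta>.conj_act_linear V\<delta>.conj_act_tensor_of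
    antipode_simps antipode_one neg clinearD[OF clinear_V\<delta>_coact] V\<delta>.act_one
    schwarzian_commute schwarzian_commute_left power2_eq_square
    scaleC_two V\<delta>.conj_linear tensor_minus_left tensor_minus_right tensor_diff_left tensor_diff_right
    tensor_zero_right scaleC_half_add
  {
    case (X v)
    show ?case
      by (rule V\<delta>_eqI[OF lin]) (simp_all add: eval)
  next
    case (Y v)
    show ?case
      by (rule V\<delta>_eqI[OF lin]) (simp_all add: eval)
  next
    case (\<delta>\<^sub>1 v)
    show ?case
      by (rule V\<delta>_eqI[OF lin]) (simp_all add: eval)
  next
    case (one v)
    show ?case using hom by (simp add: V\<delta>.conj_act_one V\<delta>.act_one)
  next
    case (add g h v)
    then show ?case using hom by (simp add: V\<delta>.conj_act_linear V\<delta>.act_linear clinearD[OF clinear_V\<delta>_coact])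
  next
    case (scaleC c h v)
    then show ?case using hom by (simp add: V\<delta>.conj_act_linear V\<delta>.act_linear clinearD[OF clinear_V\<delta>_coact])
  next
    case (mult g h v)
    then show ?case using hom by (simp add: V\<delta>.conj_act_mult V\<delta>.act_mult)
  }
qed

lemma V\<delta>_stable: "tensor_lift (\<lambda>a w. w \<triangleleft> a) (\<nabla> v) = v"
proof (rule V\<delta>_eqI)
  have bil: "cbilinear (\<lambda>a (w :: V\<delta>). w \<triangleleft> a)"
    by (rule cbilinearI) (simp_all add: V\<delta>.act_linear)
  show "clinear (\<lambda>v. tensor_lift (\<lambda>a w. w \<triangleleft> a) (\<nabla> v))"
    by (intro clinear_comp[OF clinear_V\<delta>_coact] clinear_tensor_lift bil)
  show "clinear (\<lambda>v :: V\<delta>. v)" by (simp add: clinear_iff)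
  have zero: "0 \<triangleleft> h = 0" for h by (rule complex_vector.linear_0[OF clinear_act])
  show "tensor_lift (\<lambda>a w. w \<triangleleft> a) (\<nabla> \<^bold>1) = \<^bold>1" "tensor_lift (\<lambda>a w. w \<triangleleft> a) (\<nabla> \<^bold>R\<^sup>X) = \<^bold>R\<^sup>X"
    "tensor_lift (\<lambda>a w. w \<triangleleft> a) (\<nabla> \<^bold>R\<^sup>Y) = \<^bold>R\<^sup>Y" "tensor_lift (\<lambda>a w. w \<triangleleft> a) (\<nabla> \<^bold>R\<^sup>Z) = \<^bold>R\<^sup>Z"
    by (simp_all add: V\<delta>_coact_table tensor_lift_add tensor_lift_tensor_of bil V\<delta>.act_one
        V\<delta>.act_linear V\<delta>.act_mult V\<delta>_act_table zero power2_eq_square)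
qed

lemma V\<delta>_SAYD: "right_left_SAYD comult counit antipode (\<triangleleft>) \<nabla>"
proof -
  have "clinear comult" using alg_hom_comult by (simp add: alg_hom_def)
  then show ?thesis
    by (intro right_left_SAYD.intro right_left_SAYD_axioms.intro schwarzian.hopf_algebra_axioms
      V\<delta>.right_module_axioms V\<delta>.left_comodule_axioms V\<delta>_stable)
     (simp only: V\<delta>_anti_yetter_drinfeld comult3_def V\<delta>.conj_act_tensor_map)
qed

section \<open>A basis of the module\<close>

lemma V\<delta>_basis:
  "card {\<^bold>1, \<^bold>R\<^sup>X, \<^bold>R\<^sup>Y, \<^bold>R\<^sup>Z} = 4"
  "complex_vector.independent {\<^bold>1, \<^bold>R\<^sup>X, \<^bold>R\<^sup>Y, \<^bold>R\<^sup>Z}"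
  "complex_vector.span {\<^bold>1, \<^bold>R\<^sup>X, \<^bold>R\<^sup>Y, \<^bold>R\<^sup>Z} = (UNIV :: V\<delta> set)"
proof -
  \<comment> \<open>A functional that vanishes on \<open>B\<close> separates \<open>b\<close> from the span of \<open>B\<close>.\<close>
  have notin: "b \<notin> complex_vector.span B"
    if "V\<delta>_lin a x y z b = 1" "\<And>v. v \<in> B \<Longrightarrow> V\<delta>_lin a x y z v = 0"
    for a x y z :: complex and b :: V\<delta> and B
    using that complex_vector.linear_eq_0_on_span[where x = b, OF clinear_V\<delta>_lin that(2)] by auto
  have out: "\<^bold>1 \<notin> complex_vector.span {\<^bold>R\<^sup>X, \<^bold>R\<^sup>Y, \<^bold>R\<^sup>Z}" "\<^bold>R\<^sup>X \<notin> complex_vector.span {\<^bold>R\<^sup>Y, \<^bold>R\<^sup>Z}"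
    "\<^bold>R\<^sup>Y \<notin> complex_vector.span {\<^bold>R\<^sup>Z}" "\<^bold>R\<^sup>Z \<notin> complex_vector.span {}"
    by (rule notin[of 1 0 0 0] notin[of 0 1 0 0] notin[of 0 0 1 0] notin[of 0 0 0 1]; force)+
  then have mem: "\<^bold>1 \<notin> {\<^bold>R\<^sup>X, \<^bold>R\<^sup>Y, \<^bold>R\<^sup>Z}" "\<^bold>R\<^sup>X \<notin> {\<^bold>R\<^sup>Y, \<^bold>R\<^sup>Z}" "\<^bold>R\<^sup>Y \<notin> {\<^bold>R\<^sup>Z}"
    by (meson complex_vector.span_base)+
  then show "card {\<^bold>1, \<^bold>R\<^sup>X, \<^bold>R\<^sup>Y, \<^bold>R\<^sup>Z} = 4" by simp
  show "complex_vector.independent {\<^bold>1, \<^bold>R\<^sup>X, \<^bold>R\<^sup>Y, \<^bold>R\<^sup>Z}"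
    by (intro complex_vector.independent_insertI out complex_vector.independent_empty)
  have "V\<delta>_lin \<^bold>1 \<^bold>R\<^sup>X \<^bold>R\<^sup>Y \<^bold>R\<^sup>Z v \<in> complex_vector.span {\<^bold>1, \<^bold>R\<^sup>X, \<^bold>R\<^sup>Y, \<^bold>R\<^sup>Z}" for v
  proof (induction v rule: tensor_induct)
    case (tensor p c)
    show ?case
      unfolding V\<delta>_lin_def tensor_lift_tensor_of[OF cbilinear_V\<delta>_lin]
      by (intro complex_vector.span_add complex_vector.span_scale complex_vector.span_base) simp_all
  next
    case (add s t)
    then show ?case by (simp add: clinearD[OF clinear_V\<delta>_lin] complex_vector.span_add)
  qed
  then show "complex_vector.span {\<^bold>1, \<^bold>R\<^sup>X, \<^bold>R\<^sup>Y, \<^bold>R\<^sup>Z} = (UNIV :: V\<delta> set)"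
    by (auto simp: V\<delta>_expand)
qed

theorem proposition4p2p40:
  shows "card {\<^bold>1, \<^bold>R\<^sup>X, \<^bold>R\<^sup>Y, \<^bold>R\<^sup>Z} = 4
    \<and> complex_vector.independent {\<^bold>1, \<^bold>R\<^sup>X, \<^bold>R\<^sup>Y, \<^bold>R\<^sup>Z}
    \<and> complex_vector.span {\<^bold>1, \<^bold>R\<^sup>X, \<^bold>R\<^sup>Y, \<^bold>R\<^sup>Z} = (UNIV :: V\<delta> set)
    \<and> \<^bold>1 \<triangleleft> X = 0     \<and> \<^bold>1 \<triangleleft> Y = \<^bold>1             \<and> \<^bold>1 \<triangleleft> \<delta>\<^sub>1 = \<^bold>R\<^sup>Z
    \<and> \<^bold>R\<^sup>X \<triangleleft> X = - \<^bold>R\<^sup>Y \<and> \<^bold>R\<^sup>X \<triangleleft> Y = 2 *\<^sub>C \<^bold>R\<^sup>X \<and> \<^bold>R\<^sup>X \<triangleleft> \<delta>\<^sub>1 = 0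
    \<and> \<^bold>R\<^sup>Y \<triangleleft> X = - \<^bold>R\<^sup>Z \<and> \<^bold>R\<^sup>Y \<triangleleft> Y = \<^bold>R\<^sup>Y       \<and> \<^bold>R\<^sup>Y \<triangleleft> \<delta>\<^sub>1 = 0
    \<and> \<^bold>R\<^sup>Z \<triangleleft> X = 0     \<and> \<^bold>R\<^sup>Z \<triangleleft> Y = 0         \<and> \<^bold>R\<^sup>Z \<triangleleft> \<delta>\<^sub>1 = 0
    \<and> \<nabla> \<^bold>1 = 1 \<otimes> \<^bold>1 + X \<otimes> \<^bold>R\<^sup>X + Y \<otimes> \<^bold>R\<^sup>Y
    \<and> \<nabla> \<^bold>R\<^sup>X = 1 \<otimes> \<^bold>R\<^sup>X
    \<and> \<nabla> \<^bold>R\<^sup>Y = 1 \<otimes> \<^bold>R\<^sup>Y + \<delta>\<^sub>1 \<otimes> \<^bold>R\<^sup>X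
    \<and> \<nabla> \<^bold>R\<^sup>Z = 1 \<otimes> \<^bold>R\<^sup>Z + \<delta>\<^sub>1 \<otimes> \<^bold>R\<^sup>Y + ((1/2) *\<^sub>C (\<delta>\<^sub>1 ^ 2)) \<otimes> \<^bold>R\<^sup>X
    \<and> right_left_SAYD comult counit antipode (\<triangleleft>) \<nabla>"
  by (intro conjI V\<delta>_basis V\<delta>_act_table V\<delta>_coact_table V\<delta>_SAYD)

end
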